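(* Let $(G,V,E)$ be a graph, and let $p_1^{(|E|)},\dots,p_{|V|}^{(|E|)}\in\mathbb{Q}[x]$ be the polynomials such that, for all $n\gg0$, $$\mathrm{rank}_{\mathbb{Z}}(H_{|E|}(\mathrm{Conf}_n^{\mathrm{sink}}(G,V)))=p_1^{(|E|)}(n)+p_2^{(|E|)}(n)2^n+\cdots+p_{|V|}^{(|E|)}(n)|V|^n.$$ Then $p_{|V|}^{(|E|)}$ has degree $|E|$. In particular, for $n\gg0$, the space $\mathrm{Conf}_n^{\mathrm{sink}}(G,V)$ has homological dimension $|E|$.
   Context: A graph $(G,V,E)$ is a compact connected CW complex $G$ of dimension one together with its set $V$ of 0-cells (vertices) and its set $E$ of 1-cells (edges); loops and multiple edges are allowed. $\mathrm{Conf}_n^{\mathrm{sink}}(G,V)=\{(x_1,\dots,x_n)\in G^n \mid \text{for all } i\neq j:\ x_i\neq x_j \text{ or } x_i=x_j\in V\}$, with the subspace topology from $G^n$. Homology has integer coefficients. The homological dimension of a space $Y$ is the largest $i$ with $H_i(Y)\ne0$. It is known (from an earlier result of the paper) that for each $i\ge0$ there are polynomials $p_1^{(i)},\dots,p_{\delta_i}^{(i)}\in\mathbb{Q}[x]$, with $\delta_i=\min\{i+1,|V|\}$, such that $\mathrm{rank}_{\mathbb{Z}}H_i(\mathrm{Conf}_n^{\mathrm{sink}}(G,V))=\sum_{j=1}^{\delta_i}p_j^{(i)}(n)j^n$ for all $n\gg0$; they are unique. For $i=|E|$ one has $\delta_{|E|}=|V|$ since $G$ is connected. *)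

theory Defs
  imports "HOL-Homology.Homology" "HOL-Computational_Algebra.Polynomial" "HOL-Library.Extended_Nat"
begin

section \<open>Graphs as one-dimensional CW complexes\<close>

text \<open>
  A CW structure of dimension one on \<open>X\<close> in Whitehead's form: \<open>V\<close> is the set of 0-cells (as points)
  and \<open>E\<close> the set of open 1-cells (as subsets of the space). The cells partition the space, each 1-cell
  has a characteristic map from the closed interval that is allowed to identify the two end
  points (loops), and the space carries the weak topology with respect to the closed cells.
  Closure-finiteness needs no separate clause, as the boundary of a 1-cell
  consists of at most two 0-cells. Having dimension one (rather than at most one) means that
  there is at least one 1-cell.
\<close>

definition characteristic_map_1 :: "'a topology \<Rightarrow> 'a set \<Rightarrow> 'a set \<Rightarrow> (real \<Rightarrow> 'a) \<Rightarrow> bool" where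
  "characteristic_map_1 X V e \<phi> \<longleftrightarrow>
     continuous_map (top_of_set {0..1}) X \<phi> \<and>
     homeomorphic_map (top_of_set {0<..<1}) (subtopology X e) \<phi> \<and>
     \<phi> 0 \<in> V \<and> \<phi> 1 \<in> V"

definition CW_complex_1 :: "'a topology \<Rightarrow> 'a set \<Rightarrow> 'a set set \<Rightarrow> bool" where
  "CW_complex_1 X V E \<longleftrightarrow>
     Hausdorff_space X \<and>
     V \<union> \<Union>E = topspace X \<and> V \<inter> \<Union>E = {} \<and> pairwise disjnt E \<and>
     E \<noteq> {} \<and>
     (\<forall>e\<in>E. \<exists>\<phi>. characteristic_map_1 X V e \<phi>) \<and>
     (\<forall>A. A \<subseteq> topspace X \<longrightarrow>
        (closedin X A \<longleftrightarrow>
           (\<forall>v\<in>V. closedin X (A \<inter> {v})) \<and> (\<forall>e\<in>E. closedin X (A \<inter> X closure_of e))))"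

text \<open>Compactness and the weak topology force \<open>V\<close> and \<open>E\<close> to be finite.\<close>

definition CW_graph :: "'a topology \<Rightarrow> 'a set \<Rightarrow> 'a set set \<Rightarrow> bool" where
  "CW_graph X V E \<longleftrightarrow> CW_complex_1 X V E \<and> compact_space X \<and> connected_space X"


section \<open>Sink configuration spaces\<close>

definition conf_sink :: "nat \<Rightarrow> 'a topology \<Rightarrow> 'a set \<Rightarrow> (nat \<Rightarrow> 'a) topology" where
  "conf_sink n X V =
     subtopology (product_topology (\<lambda>_. X) {1..n})
       {x. \<forall>i\<in>{1..n}. \<forall>j\<in>{1..n}. i \<noteq> j \<longrightarrow> x i \<noteq> x j \<or> (x i = x j \<and> x i \<in> V)}"


section \<open>Rank of an abelian group and homological dimension\<close>

text \<open>
  Abelian groups are written multiplicatively, as the homology groups of the library are. The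
  rank is the supremum of the sizes of finite \<open>\<int>\<close>-linearly independent subsets; it is
  \<open>\<infinity>\<close> if these sizes are unbounded.
\<close>

definition int_independent :: "('a, 'b) monoid_scheme \<Rightarrow> 'a set \<Rightarrow> bool" where
  "int_independent A S \<longleftrightarrow>
     finite S \<and> S \<subseteq> carrier A \<and>
     (\<forall>c :: 'a \<Rightarrow> int.
        finprod A (\<lambda>x. x [^]\<^bsub>A\<^esub> c x) S = \<one>\<^bsub>A\<^esub> \<longrightarrow> (\<forall>x\<in>S. c x = 0))"

definition int_rank :: "('a, 'b) monoid_scheme \<Rightarrow> enat" where
  "int_rank A = (SUP S \<in> {S. int_independent A S}. enat (card S))"

definition has_homological_dimension :: "'a topology \<Rightarrow> nat \<Rightarrow> bool" where
  "has_homological_dimension Y d \<longleftrightarrow>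
     \<not> trivial_group (homology_group (int d) Y) \<and>
     (\<forall>i>d. trivial_group (homology_group (int i) Y))"

end

theory Submission
  imports Defs
begin

text \<open>
  Let \<open>F\<close> be a set of edges, \<open>d\<close> its cardinality, and \<open>W(I)\<close> the space of sink configurations of a finite
  set \<open>I\<close> of particles in \<open>V \<union> \<Union>F\<close>. The theorem follows from two facts about \<open>W(I)\<close>: its homology
  vanishes above degree \<open>d\<close>, and the rank of its homology in degree \<open>d\<close> lies between two positive
  multiples of \<open>n ^ d * card V ^ n\<close> once \<open>n = card I\<close> is large (\<open>sink_conf_homology_growth\<close>). For
  the set of all edges this rank is an exponential polynomial by assumption, and the coefficient of
  its largest base must grow like \<open>n ^ d\<close> (\<open>degree_dominant_polynomial\<close>).

  Both facts are proved by removing one edge \<open>e\<close>, by induction on \<open>d\<close>. Let \<open>Y(I)\<close> be the configuration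
  space with \<open>e\<close> and \<open>W(I)\<close> that without \<open>e\<close>. A particle at the midpoint of \<open>e\<close> is there alone. If no
  particle is at the midpoint, all particles on \<open>e\<close> can be pushed out of \<open>e\<close> simultaneously, so this
  open subset of \<open>Y(I)\<close> is homotopy equivalent to \<open>W(I)\<close>. The remaining configurations are contained in
  the disjoint open sets where one particle \<open>i\<close> is on \<open>e\<close> and strictly closest to the midpoint; each of
  these is homotopy equivalent to \<open>W(I - {i})\<close>, and so are its two parts in which \<open>i\<close> lies to the left
  or to the right of the midpoint. Excision and the long exact sequences for this cover
  (\<open>homology_open_cover_upper\<close>, \<open>homology_open_cover_lower\<close>) then yield, for the ranks \<open>y\<close> and \<open>w\<close> of
  the top homology groups of \<open>Y(I)\<close> and \<open>W(I)\<close> and the sum \<open>s\<close> of those of the \<open>W(I - {i})\<close>,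
  that \<open>y \<le> 2 * s\<close> and \<open>s \<le> y + w\<close>. Since \<open>s\<close> is a sum of \<open>n\<close> terms, it is larger than \<open>w\<close> by a
  factor of order \<open>n\<close>, so \<open>y\<close> has the order of growth of \<open>s\<close>. The induction starts with the
  \<open>card V ^ n\<close> points of the configuration space of \<open>V\<close>.

  Ranks of abelian groups are only used through subadditivity in exact sequences (\<open>int_rank_exact\<close>)
  and additivity for direct products (\<open>int_rank_DirProd\<close>).
\<close>

section \<open>The rank of an abelian group\<close>

text \<open>
  Independent sets are awkward under homomorphisms, which may identify elements. A family keeps
  its index set, and a dependence between its members is visible even if two of them coincide.
\<close>

definition int_independent_family :: "('a, 'b) monoid_scheme \<Rightarrow> 'i set \<Rightarrow> ('i \<Rightarrow> 'a) \<Rightarrow> bool" where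
  "int_independent_family A J a \<longleftrightarrow>
     finite J \<and> a \<in> J \<rightarrow> carrier A \<and>
     (\<forall>c :: 'i \<Rightarrow> int.
        finprod A (\<lambda>j. a j [^]\<^bsub>A\<^esub> c j) J = \<one>\<^bsub>A\<^esub> \<longrightarrow> (\<forall>j\<in>J. c j = 0))"

lemma int_independentD:
  fixes c :: "'a \<Rightarrow> int"
  assumes "int_independent A S" "finprod A (\<lambda>x. x [^]\<^bsub>A\<^esub> c x) S = \<one>\<^bsub>A\<^esub>" "x \<in> S"
  shows "c x = 0"
  using assms by (auto simp: int_independent_def)

lemma finprod_hom:
  assumes "comm_group A" "comm_group B" "f \<in> hom A B" "a \<in> J \<rightarrow> carrier A"
  shows "f (finprod A a J) = finprod B (\<lambda>j. f (a j)) J"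
proof -
  interpret A: comm_group A by fact
  interpret B: comm_group B by fact
  interpret group_hom A B f
    using assms by (simp add: group_hom_def group_hom_axioms_def A.is_group B.is_group)
  show ?thesis
    using \<open>a \<in> J \<rightarrow> carrier A\<close>
  proof (induction J rule: infinite_finite_induct)
    case (insert j J)
    then show ?case
      by (subst A.finprod_insert, simp, simp, force, force, subst B.finprod_insert)
         (auto simp: Pi_def)
  qed auto
qed

lemma finprod_hom_int_pow:
  fixes c :: "'i \<Rightarrow> int"
  assumes "comm_group A" "comm_group B" "f \<in> hom A B" "a \<in> J \<rightarrow> carrier A"
  shows "f (finprod A (\<lambda>j. a j [^]\<^bsub>A\<^esub> c j) J) = finprod B (\<lambda>j. f (a j) [^]\<^bsub>B\<^esub> c j) J"
proof -
  interpret A: comm_group A by fact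
  interpret B: comm_group B by fact
  interpret group_hom A B f
    using assms by (simp add: group_hom_def group_hom_axioms_def A.is_group B.is_group)
  have "f (finprod A (\<lambda>j. a j [^]\<^bsub>A\<^esub> c j) J) = finprod B (\<lambda>j. f (a j [^]\<^bsub>A\<^esub> c j)) J"
    using assms by (intro finprod_hom) (auto simp: Pi_def)
  also have "\<dots> = finprod B (\<lambda>j. f (a j) [^]\<^bsub>B\<^esub> c j) J"
    using assms by (intro B.finprod_cong') (auto simp: Pi_def hom_int_pow)
  finally show ?thesis .
qed

text \<open>
  In additive notation: a combination of combinations has the coefficients of a matrix product.
\<close>

lemma (in comm_group) finprod_int_pow_combination:
  fixes c :: "'r \<Rightarrow> 'i \<Rightarrow> int"
  assumes "a \<in> J \<rightarrow> carrier G" "finite R"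
  shows "finprod G (\<lambda>r. finprod G (\<lambda>j. a j [^] c r j) J [^] k r) R
       = finprod G (\<lambda>j. a j [^] (\<Sum>r\<in>R. k r * c r j)) J"
  using \<open>finite R\<close>
proof (induction R rule: finite_induct)
  case empty
  then show ?case by simp
next
  case (insert r R)
  have pow: "finprod G (\<lambda>j. a j [^] c r j) J [^] k r = finprod G (\<lambda>j. a j [^] (k r * c r j)) J"
  proof -
    have "(\<lambda>x. x [^] k r) \<in> hom G G"
      by (auto simp: hom_def int_pow_distrib)
    then have "finprod G (\<lambda>j. a j [^] c r j) J [^] k r = finprod G (\<lambda>j. (a j [^] c r j) [^] k r) J"
      using assms by (intro finprod_hom[of G G "\<lambda>x. x [^] k r"]) (auto simp: comm_group_axioms)
    also have "\<dots> = finprod G (\<lambda>j. a j [^] (k r * c r j)) J"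
      using assms by (intro finprod_cong') (auto simp: Pi_def int_pow_pow mult.commute)
    finally show ?thesis .
  qed
  have "finprod G (\<lambda>r. finprod G (\<lambda>j. a j [^] c r j) J [^] k r) (insert r R)
      = finprod G (\<lambda>j. a j [^] (k r * c r j)) J \<otimes> finprod G (\<lambda>j. a j [^] (\<Sum>r\<in>R. k r * c r j)) J"
    using insert assms by (subst finprod_insert) (auto simp: pow Pi_def)
  also have "\<dots> = finprod G (\<lambda>j. a j [^] (k r * c r j) \<otimes> a j [^] (\<Sum>r\<in>R. k r * c r j)) J"
    using assms by (subst finprod_multf) (auto simp: Pi_def)
  also have "\<dots> = finprod G (\<lambda>j. a j [^] (\<Sum>r\<in>insert r R. k r * c r j)) J"
    using assms insert by (intro finprod_cong') (auto simp: Pi_def int_pow_mult)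
  finally show ?case .
qed

lemma int_independent_family_inj_on:
  assumes "comm_group A" "int_independent_family A J a"
  shows "inj_on a J"
proof (rule inj_onI, rule ccontr)
  interpret comm_group A by fact
  fix i j assume ij: "i \<in> J" "j \<in> J" "a i = a j" "i \<noteq> j"
  define c :: "_ \<Rightarrow> int" where "c = (\<lambda>l. if l = i then 1 else if l = j then -1 else 0)"
  have fin: "finite J" and car: "a \<in> J \<rightarrow> carrier A"
    using assms by (auto simp: int_independent_family_def)
  have "finprod A (\<lambda>l. a l [^]\<^bsub>A\<^esub> c l) J = finprod A (\<lambda>l. a l [^]\<^bsub>A\<^esub> c l) {i,j}"
    using ij fin car by (intro finprod_mono_neutral_cong_right) (auto simp: c_def)
  also have "\<dots> = \<one>\<^bsub>A\<^esub>"
    using ij car by (subst finprod_insert) (auto simp: c_def Pi_def int_pow_neg)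
  finally have "c i = 0"
    using assms ij by (auto simp: int_independent_family_def)
  then show False by (simp add: c_def)
qed

text \<open>
  Comparing a repeated member with itself gives a nontrivial relation, so an independent family is
  injective and its image is an independent set of the same size.
\<close>

lemma card_le_int_rank:
  assumes "comm_group A" "int_independent_family A J a"
  shows "enat (card J) \<le> int_rank A"
proof -
  interpret comm_group A by fact
  have inj: "inj_on a J" by (rule int_independent_family_inj_on[OF assms])
  have fin: "finite J" and car: "a \<in> J \<rightarrow> carrier A"
    using assms by (auto simp: int_independent_family_def)
  have "int_independent A (a ` J)"
    unfolding int_independent_def
  proof (intro conjI allI impI)
    fix c :: "_ \<Rightarrow> int" assume "finprod A (\<lambda>x. x [^]\<^bsub>A\<^esub> c x) (a ` J) = \<one>\<^bsub>A\<^esub>"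
    then have "finprod A (\<lambda>j. a j [^]\<^bsub>A\<^esub> c (a j)) J = \<one>\<^bsub>A\<^esub>"
      using inj car by (subst (asm) finprod_reindex) auto
    then show "\<forall>x\<in>a ` J. c x = 0"
      using assms unfolding int_independent_family_def by force
  qed (use fin car in auto)
  moreover have "card (a ` J) = card J" using inj by (rule card_image)
  ultimately show ?thesis
    unfolding int_rank_def by (metis (mono_tags) SUP_upper mem_Collect_eq)
qed

lemma int_rank_leI:
  assumes "\<And>S. int_independent A S \<Longrightarrow> enat (card S) \<le> r"
  shows "int_rank A \<le> r"
  unfolding int_rank_def using assms by (auto intro: SUP_least)

text \<open>
  Addition of \<open>enat\<close> commutes with the supremum over the independent sets; the supremum ranges over
  a nonempty set, as the empty set is independent.
\<close>

lemma int_rank_add_leI: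
  fixes b r :: enat
  assumes "\<And>S. int_independent A S \<Longrightarrow> enat (card S) + b \<le> r"
  shows "int_rank A + b \<le> r"
proof -
  have ind: "int_independent A {}" by (simp add: int_independent_def)
  show ?thesis
  proof (cases "b = \<infinity> \<or> r = \<infinity>")
    case True
    then show ?thesis using assms[OF ind] by auto
  next
    case False
    then obtain k m where km: "b = enat k" "r = enat m" by auto
    have "k \<le> m" using assms[OF ind] km by (simp flip: zero_enat_def)
    have "int_rank A \<le> enat (m - k)"
      using assms by (intro int_rank_leI) (force simp: km)
    then have "int_rank A + b \<le> enat (m - k) + enat k"
      unfolding km(1) by (rule add_right_mono)
    then show ?thesis using km \<open>k \<le> m\<close> by simp
  qed
qed

text \<open>
  This replaces rank-nullity for vector spaces. Split an independent set \<open>S\<close> of \<open>B\<close> into a maximal part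
  \<open>T\<close> that stays independent in \<open>C\<close> and the rest. Each remaining element satisfies a relation over
  \<open>T\<close> in \<open>C\<close>; the same combination formed in \<open>B\<close> dies in \<open>C\<close>, so it comes from \<open>A\<close>. The elements of
  \<open>A\<close> found in this way are independent, because the relations are triangular.
\<close>

lemma int_rank_exact:
  assumes cA: "comm_group A" and cB: "comm_group B" and cC: "comm_group C"
    and f: "f \<in> hom A B" and g: "g \<in> hom B C"
    and ex: "kernel B C g \<subseteq> f ` carrier A"
  shows "int_rank B \<le> int_rank A + int_rank C"
proof (rule int_rank_leI)
  interpret A: comm_group A by fact
  interpret B: comm_group B by fact
  interpret C: comm_group C by fact
  fix S assume S: "int_independent B S"
  then have finS: "finite S" and SB: "S \<subseteq> carrier B" by (auto simp: int_independent_def)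
  \<comment> \<open>A maximal part \<open>T\<close> of \<open>S\<close> whose image in \<open>C\<close> is independent.\<close>
  define P where "P T \<longleftrightarrow> T \<subseteq> S \<and> int_independent_family C T g" for T
  have "P {}" by (auto simp: P_def int_independent_family_def)
  moreover have "\<And>T. P T \<Longrightarrow> card T \<le> card S" using finS by (auto simp: P_def intro: card_mono)
  ultimately obtain T where T: "P T" and max: "\<And>T'. P T' \<Longrightarrow> card T' \<le> card T"
    using ex_has_greatest_nat[of P "{}" card "Suc (card S)"] by (auto simp: less_Suc_eq_le)
  have TS: "T \<subseteq> S" and Tind: "int_independent_family C T g" using T by (auto simp: P_def)
  have finT: "finite T" using TS finS by (rule finite_subset)
  have gcar: "g x \<in> carrier C" if "x \<in> S" for x
    using g SB that by (auto simp: hom_def)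
  define R where "R = S - T"
  \<comment> \<open>By maximality of \<open>T\<close> every other element of \<open>S\<close> depends on \<open>T\<close> in \<open>C\<close>, with a
  nonzero coefficient of its own.\<close>
  have "\<exists>c :: _ \<Rightarrow> int. c s \<noteq> 0 \<and> (\<forall>x. x \<notin> insert s T \<longrightarrow> c x = 0) \<and>
          finprod C (\<lambda>x. g x [^]\<^bsub>C\<^esub> c x) S = \<one>\<^bsub>C\<^esub>" if s: "s \<in> R" for s
  proof -
    have sT: "s \<in> S" "s \<notin> T" using s by (auto simp: R_def)
    have "\<not> P (insert s T)"
      using max[of "insert s T"] finT sT by auto
    then obtain c :: "_ \<Rightarrow> int" where c: "finprod C (\<lambda>x. g x [^]\<^bsub>C\<^esub> c x) (insert s T) = \<one>\<^bsub>C\<^esub>"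
        and nz: "\<not> (\<forall>x\<in>insert s T. c x = 0)"
      using TS sT finT gcar by (auto simp: P_def int_independent_family_def Pi_def)
    have "c s \<noteq> 0"
    proof
      assume "c s = 0"
      then have "finprod C (\<lambda>x. g x [^]\<^bsub>C\<^esub> c x) T = \<one>\<^bsub>C\<^esub>"
        using c sT finT gcar TS by (subst (asm) C.finprod_insert) (auto simp: Pi_def subset_iff)
      then have "\<forall>x\<in>T. c x = 0" using Tind by (auto simp: int_independent_family_def)
      then show False using nz \<open>c s = 0\<close> by auto
    qed
    moreover have "finprod C (\<lambda>x. g x [^]\<^bsub>C\<^esub> (if x \<in> insert s T then c x else 0)) S = \<one>\<^bsub>C\<^esub>"
      unfolding c[symmetric]
      using TS sT finS gcar by (intro C.finprod_mono_neutral_cong_right) auto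
    ultimately show ?thesis
      by (intro exI[of _ "\<lambda>x. if x \<in> insert s T then c x else 0"]) auto
  qed
  then obtain c :: "_ \<Rightarrow> _ \<Rightarrow> int"
    where c: "\<And>s. s \<in> R \<Longrightarrow> c s s \<noteq> 0" "\<And>s x. s \<in> R \<Longrightarrow> x \<notin> insert s T \<Longrightarrow> c s x = 0"
      and cprod: "\<And>s. s \<in> R \<Longrightarrow> finprod C (\<lambda>x. g x [^]\<^bsub>C\<^esub> c s x) S = \<one>\<^bsub>C\<^esub>"
    by metis
  define b where "b s = finprod B (\<lambda>x. x [^]\<^bsub>B\<^esub> c s x) S" for s
  have bcar: "b s \<in> carrier B" for s
    using SB by (auto simp: b_def intro!: B.finprod_closed)
  have "b s \<in> f ` carrier A" if "s \<in> R" for s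
  proof -
    have "g (b s) = \<one>\<^bsub>C\<^esub>"
      unfolding b_def using SB cprod[OF that]
      by (subst finprod_hom_int_pow[OF cB cC g]) auto
    then show ?thesis using ex bcar[of s] by (auto simp: kernel_def)
  qed
  then have "\<exists>y. y \<in> carrier A \<and> f y = b s" if "s \<in> R" for s
    using that by (metis imageE)
  then obtain a where a: "\<And>s. s \<in> R \<Longrightarrow> a s \<in> carrier A" "\<And>s. s \<in> R \<Longrightarrow> f (a s) = b s"
    by metis
  have finR: "finite R" using finS by (simp add: R_def)
  have "int_independent_family A R a"
    unfolding int_independent_family_def
  proof (intro conjI allI impI)
    fix k :: "_ \<Rightarrow> int" assume k: "finprod A (\<lambda>s. a s [^]\<^bsub>A\<^esub> k s) R = \<one>\<^bsub>A\<^esub>"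
    have "\<one>\<^bsub>B\<^esub> = f (finprod A (\<lambda>s. a s [^]\<^bsub>A\<^esub> k s) R)"
      using f by (simp add: k hom_one A.is_group B.is_group)
    also have "\<dots> = finprod B (\<lambda>s. f (a s) [^]\<^bsub>B\<^esub> k s) R"
      using a by (intro finprod_hom_int_pow[OF cA cB f]) auto
    also have "\<dots> = finprod B (\<lambda>s. b s [^]\<^bsub>B\<^esub> k s) R"
      using a bcar by (intro B.finprod_cong') auto
    also have "\<dots> = finprod B (\<lambda>x. x [^]\<^bsub>B\<^esub> (\<Sum>s\<in>R. k s * c s x)) S"
      unfolding b_def using SB finR by (intro B.finprod_int_pow_combination) auto
    finally have z: "\<forall>x\<in>S. (\<Sum>s\<in>R. k s * c s x) = 0"
      using S[unfolded int_independent_def] by metis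
    show "\<forall>x\<in>R. k x = 0"
    proof
      fix x assume x: "x \<in> R"
      \<comment> \<open>Among the relations only that of \<open>x\<close> involves \<open>x\<close>, as \<open>x\<close> is outside \<open>T\<close>.\<close>
      have "(\<Sum>s\<in>R. k s * c s x) = (\<Sum>s\<in>{x}. k s * c s x)"
        using x finR c(2) by (intro sum.mono_neutral_right) (auto simp: R_def)
      then show "k x = 0" using z x c(1)[OF x] by (auto simp: R_def)
    qed
  qed (use a finR in auto)
  then have "enat (card R) \<le> int_rank A" by (rule card_le_int_rank[OF cA])
  moreover have "enat (card T) \<le> int_rank C" by (rule card_le_int_rank[OF cC Tind])
  moreover have "card S = card R + card T"
    unfolding R_def using TS finT finS by (simp add: card_Diff_subset card_mono)
  ultimately show "enat (card S) \<le> int_rank A + int_rank C"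
    by (metis add_mono plus_enat_simps(1))
qed

lemma int_rank_trivial_group:
  assumes "trivial_group A"
  shows "int_rank A = 0"
proof -
  interpret group A using assms by (simp add: trivial_group_def)
  interpret comm_group A
    using assms by unfold_locales (auto simp: trivial_group_def)
  have "card S = 0" if S: "int_independent A S" for S
  proof -
    have "S \<subseteq> {\<one>\<^bsub>A\<^esub>}" using S assms by (auto simp: int_independent_def trivial_group_def)
    then have "finprod A (\<lambda>x. x [^]\<^bsub>A\<^esub> (1::int)) S = \<one>\<^bsub>A\<^esub>"
      by (intro finprod_one_eqI) auto
    from int_independentD[OF S this] have "S = {}" by auto
    then show ?thesis by simp
  qed
  then have "int_rank A \<le> 0" by (intro int_rank_leI) (auto simp: zero_enat_def)
  then show ?thesis by simp
qed

lemma int_rank_le_of_inj_hom: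
  assumes "comm_group A" "comm_group B" "f \<in> hom A B" "inj_on f (carrier A)"
  shows "int_rank A \<le> int_rank B"
proof -
  interpret A: comm_group A by fact
  interpret B: comm_group B by fact
  define Z where "Z = (singleton_group \<one>\<^bsub>A\<^esub>)"
  have tZ: "trivial_group Z" by (simp add: Z_def)
  have cZ: "comm_group Z"
    using tZ by (intro group.group_comm_groupI) (auto simp: trivial_group_def)
  have "int_rank A \<le> int_rank Z + int_rank B"
  proof (rule int_rank_exact[of _ _ _ "\<lambda>_. \<one>\<^bsub>A\<^esub>" f])
    show "(\<lambda>_. \<one>\<^bsub>A\<^esub>) \<in> hom Z A" by (auto simp: hom_def)
    have "x = \<one>\<^bsub>A\<^esub>" if "x \<in> carrier A" "f x = \<one>\<^bsub>B\<^esub>" for x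
      using assms that hom_one[OF assms(3) A.is_group B.is_group] by (auto simp: inj_on_def)
    then show "kernel A B f \<subseteq> (\<lambda>_. \<one>\<^bsub>A\<^esub>) ` carrier Z"
      by (auto simp: kernel_def Z_def singleton_group_def)
  qed (use assms cZ in auto)
  then show ?thesis by (simp add: int_rank_trivial_group[OF tZ])
qed

lemma int_rank_iso:
  assumes "comm_group A" "comm_group B" "A \<cong> B"
  shows "int_rank A = int_rank B"
proof -
  have "B \<cong> A"
    using assms by (simp add: group.iso_sym comm_group_def)
  then obtain f g where "f \<in> iso A B" "g \<in> iso B A"
    using assms(3) by (auto simp: is_iso_def)
  then show ?thesis
    using assms by (intro order_antisym int_rank_le_of_inj_hom[of A B f] int_rank_le_of_inj_hom[of B A g])
      (auto simp: iso_def bij_betw_def)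
qed

lemma comm_group_DirProd:
  assumes "comm_group A" "comm_group B"
  shows "comm_group (A \<times>\<times> B)"
proof (rule group.group_comm_groupI)
  show "group (A \<times>\<times> B)" using assms by (simp add: DirProd_group comm_group_def)
  interpret A: comm_group A by fact
  interpret B: comm_group B by fact
  show "x \<otimes>\<^bsub>A \<times>\<times> B\<^esub> y = y \<otimes>\<^bsub>A \<times>\<times> B\<^esub> x"
    if "x \<in> carrier (A \<times>\<times> B)" "y \<in> carrier (A \<times>\<times> B)" for x y
    using that by (cases x; cases y) (simp add: A.m_comm B.m_comm)
qed

lemma int_rank_DirProd:
  assumes cA: "comm_group A" and cB: "comm_group B"
  shows "int_rank (A \<times>\<times> B) = int_rank A + int_rank B"
proof (rule order_antisym)
  interpret A: comm_group A by fact
  interpret B: comm_group B by fact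
  interpret AB: comm_group "A \<times>\<times> B" using assms by (rule comm_group_DirProd)
  have hom1: "fst \<in> hom (A \<times>\<times> B) A" and hom2: "snd \<in> hom (A \<times>\<times> B) B"
    by (auto simp: hom_def DirProd_def)
  show "int_rank (A \<times>\<times> B) \<le> int_rank A + int_rank B"
  proof (rule int_rank_exact[of _ _ _ "\<lambda>x. (x, \<one>\<^bsub>B\<^esub>)" snd])
    show "(\<lambda>x. (x, \<one>\<^bsub>B\<^esub>)) \<in> hom A (A \<times>\<times> B)" by (auto simp: hom_def)
  qed (use assms hom2 AB.comm_group_axioms in \<open>auto simp: kernel_def\<close>)
  show "int_rank A + int_rank B \<le> int_rank (A \<times>\<times> B)"
  proof (rule int_rank_add_leI)
    fix S assume S: "int_independent A S"
    have "int_rank B + enat (card S) \<le> int_rank (A \<times>\<times> B)"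
    proof (rule int_rank_add_leI)
      fix T assume T: "int_independent B T"
      \<comment> \<open>The disjoint sum of the index sets avoids the case that the two images overlap.\<close>
      define h where "h = case_sum (\<lambda>x. (x, \<one>\<^bsub>B\<^esub>)) (\<lambda>y. (\<one>\<^bsub>A\<^esub>, y))"
      have fin: "finite S" "finite T" and car: "S \<subseteq> carrier A" "T \<subseteq> carrier B"
        using S T by (auto simp: int_independent_def)
      have hcar: "h \<in> S <+> T \<rightarrow> carrier (A \<times>\<times> B)" using car by (auto simp: h_def)
      have "int_independent_family (A \<times>\<times> B) (S <+> T) h"
        unfolding int_independent_family_def
      proof (intro conjI allI impI)
        fix c :: "_ \<Rightarrow> int"
        assume c: "finprod (A \<times>\<times> B) (\<lambda>j. h j [^]\<^bsub>A \<times>\<times> B\<^esub> c j) (S <+> T) = \<one>\<^bsub>A \<times>\<times> B\<^esub>"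
        have "\<one>\<^bsub>A\<^esub> = finprod A (\<lambda>j. fst (h j) [^]\<^bsub>A\<^esub> c j) (S <+> T)"
          using finprod_hom_int_pow[OF AB.comm_group_axioms cA hom1 hcar, of c] by (simp add: c)
        also have "\<dots> = finprod A (\<lambda>j. fst (h j) [^]\<^bsub>A\<^esub> c j) (Inl ` S)"
          using car fin by (intro A.finprod_mono_neutral_cong_right) (auto simp: h_def)
        also have "\<dots> = finprod A (\<lambda>x. x [^]\<^bsub>A\<^esub> c (Inl x)) S"
          using car by (subst A.finprod_reindex) (auto simp: h_def)
        finally have 1: "\<forall>x\<in>S. c (Inl x) = 0"
          using S[unfolded int_independent_def] by metis
        have "\<one>\<^bsub>B\<^esub> = finprod B (\<lambda>j. snd (h j) [^]\<^bsub>B\<^esub> c j) (S <+> T)"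
          using finprod_hom_int_pow[OF AB.comm_group_axioms cB hom2 hcar, of c] by (simp add: c)
        also have "\<dots> = finprod B (\<lambda>j. snd (h j) [^]\<^bsub>B\<^esub> c j) (Inr ` T)"
          using car fin by (intro B.finprod_mono_neutral_cong_right) (auto simp: h_def)
        also have "\<dots> = finprod B (\<lambda>x. x [^]\<^bsub>B\<^esub> c (Inr x)) T"
          using car by (subst B.finprod_reindex) (auto simp: h_def)
        finally have "\<forall>x\<in>T. c (Inr x) = 0"
          using T[unfolded int_independent_def] by metis
        with 1 show "\<forall>j\<in>S <+> T. c j = 0" by auto
      qed (use fin hcar in auto)
      from card_le_int_rank[OF AB.comm_group_axioms this]
      show "enat (card T) + enat (card S) \<le> int_rank (A \<times>\<times> B)"
        using fin by (simp add: card_Plus add.commute)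
    qed
    then show "enat (card S) + int_rank B \<le> int_rank (A \<times>\<times> B)" by (simp add: add.commute)
  qed
qed

lemma int_rank_integer_group: "int_rank integer_group = 1"
proof (rule order_antisym)
  have cZ: "comm_group integer_group" by (rule abelian_integer_group)
  interpret comm_group integer_group by (rule cZ)
  have pow: "x [^]\<^bsub>integer_group\<^esub> (n::int) = n * x" for x n :: int
    by (rule group_int_pow_integer_group)
  show "int_rank integer_group \<le> 1"
  proof (rule int_rank_leI, rule ccontr)
    fix S assume S: "int_independent integer_group S" and "\<not> enat (card S) \<le> 1"
    then have "finite S" "card S \<ge> 2" by (auto simp: int_independent_def one_enat_def)
    then obtain x y where xy: "x \<in> S" "y \<in> S" "x \<noteq> y"
      by (metis card_le_Suc0_iff_eq not_less_eq_eq numeral_2_eq_2)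
    \<comment> \<open>Two integers \<open>x\<close> and \<open>y\<close> always satisfy the relation \<open>y * x - x * y = 0\<close>.\<close>
    define c where "c = (\<lambda>z. if z = x then y else if z = y then - x else 0 :: int)"
    have "finprod integer_group (\<lambda>z. z [^]\<^bsub>integer_group\<^esub> c z) S
        = finprod integer_group (\<lambda>z. z [^]\<^bsub>integer_group\<^esub> c z) {x, y}"
      using xy \<open>finite S\<close> by (intro finprod_mono_neutral_cong_right) (auto simp: c_def)
    also have "\<dots> = \<one>\<^bsub>integer_group\<^esub>"
      using xy by (subst finprod_insert) (auto simp: c_def pow)
    finally have "c x = 0" "c y = 0" using S xy by (auto simp: int_independent_def)
    then show False using xy by (auto simp: c_def split: if_splits)
  qed
  have "int_independent_family integer_group {()} (\<lambda>_. 1)"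
    by (auto simp: int_independent_family_def pow)
  from card_le_int_rank[OF cZ this] show "1 \<le> int_rank integer_group"
    by (simp add: one_enat_def)
qed

section \<open>Ranks of homology groups\<close>

lemma trivial_group_exact:
  assumes "trivial_group A" "group B" "trivial_group C"
    and f: "f \<in> hom A B" and g: "g \<in> hom B C" and ex: "kernel B C g \<subseteq> f ` carrier A"
  shows "trivial_group B"
proof -
  interpret B: group B by fact
  have "carrier B \<subseteq> kernel B C g"
    using assms by (auto simp: kernel_def trivial_group_def hom_def)
  also have "\<dots> \<subseteq> {\<one>\<^bsub>B\<^esub>}"
    using ex assms hom_one[OF f _ \<open>group B\<close>] by (auto simp: trivial_group_def)
  finally show ?thesis by (simp add: B.trivial_group_subset)
qed

text \<open>
  Each inequality is \<open>int_rank_exact\<close> at one of the three positions of the long exact sequence of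
  the pair \<open>(Z, S)\<close>; vanishing passes along the same sequence.
\<close>

lemma
  shows int_rank_homology_space: "int_rank (homology_group p Z)
      \<le> int_rank (homology_group p (subtopology Z S)) + int_rank (relative_homology_group p Z S)"
    and int_rank_homology_pair: "int_rank (relative_homology_group p Z S)
      \<le> int_rank (homology_group p Z) + int_rank (homology_group (p - 1) (subtopology Z S))"
    and int_rank_homology_subspace: "int_rank (homology_group (p - 1) (subtopology Z S))
      \<le> int_rank (relative_homology_group p Z S) + int_rank (homology_group (p - 1) Z)"
    and trivial_homology_space: "trivial_group (homology_group p (subtopology Z S)) \<Longrightarrow>
      trivial_group (relative_homology_group p Z S) \<Longrightarrow> trivial_group (homology_group p Z)"
    and trivial_homology_pair: "trivial_group (homology_group p Z) \<Longrightarrow>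
      trivial_group (homology_group (p - 1) (subtopology Z S)) \<Longrightarrow>
      trivial_group (relative_homology_group p Z S)"
proof -
  note cg = abelian_relative_homology_group group_relative_homology_group
  note e = homology_exactness_axiom_1[of p Z S] homology_exactness_axiom_2[of p Z S]
    homology_exactness_axiom_3[of p Z S]
  have 1: "kernel (homology_group p Z) (relative_homology_group p Z S) (hom_induced p Z {} Z S id)
      \<subseteq> hom_induced p (subtopology Z S) {} Z {} id ` carrier (homology_group p (subtopology Z S))"
    using e(3) by auto
  have 2: "kernel (relative_homology_group p Z S) (homology_group (p - 1) (subtopology Z S)) (hom_boundary p Z S)
      \<subseteq> hom_induced p Z {} Z S id ` carrier (homology_group p Z)"
    using e(1) by auto
  have 3: "kernel (homology_group (p - 1) (subtopology Z S)) (homology_group (p - 1) Z)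
        (hom_induced (p - 1) (subtopology Z S) {} Z {} id)
      \<subseteq> hom_boundary p Z S ` carrier (relative_homology_group p Z S)"
    using e(2) by auto
  show "int_rank (homology_group p Z)
      \<le> int_rank (homology_group p (subtopology Z S)) + int_rank (relative_homology_group p Z S)"
    by (rule int_rank_exact[OF cg(1) cg(1) cg(1) hom_induced_hom hom_induced_hom 1])
  show "int_rank (relative_homology_group p Z S)
      \<le> int_rank (homology_group p Z) + int_rank (homology_group (p - 1) (subtopology Z S))"
    by (rule int_rank_exact[OF cg(1) cg(1) cg(1) hom_induced_hom hom_boundary_hom 2])
  show "int_rank (homology_group (p - 1) (subtopology Z S))
      \<le> int_rank (relative_homology_group p Z S) + int_rank (homology_group (p - 1) Z)"
    by (rule int_rank_exact[OF cg(1) cg(1) cg(1) hom_boundary_hom hom_induced_hom 3])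
  show "trivial_group (homology_group p (subtopology Z S)) \<Longrightarrow>
      trivial_group (relative_homology_group p Z S) \<Longrightarrow> trivial_group (homology_group p Z)"
    by (rule trivial_group_exact[OF _ cg(2) _ hom_induced_hom hom_induced_hom 1])
  show "trivial_group (homology_group p Z) \<Longrightarrow>
      trivial_group (homology_group (p - 1) (subtopology Z S)) \<Longrightarrow>
      trivial_group (relative_homology_group p Z S)"
    by (rule trivial_group_exact[OF _ cg(2) _ hom_induced_hom hom_boundary_hom 2])
qed

lemma excision_open_cover:
  assumes "openin Y A" "openin Y U" "A \<union> U = topspace Y"
  shows "relative_homology_group p (subtopology Y U) (U \<inter> A) \<cong> relative_homology_group p Y A"
proof -
  have AY: "A \<subseteq> topspace Y" and UY: "U \<subseteq> topspace Y"
    using assms by (auto dest: openin_subset)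
  have "closedin Y (topspace Y - U)" using assms by blast
  then have "Y closure_of (topspace Y - U) \<subseteq> Y interior_of A"
    using assms by (auto simp: closure_of_closedin interior_of_openin)
  from homology_excision_axiom[OF this AY, of p]
  have "relative_homology_group p (subtopology Y (topspace Y - (topspace Y - U))) (A - (topspace Y - U))
      \<cong> relative_homology_group p (subtopology Y (topspace Y)) A"
    unfolding is_iso_def by blast
  moreover have "topspace Y - (topspace Y - U) = U" "A - (topspace Y - U) = U \<inter> A"
    using AY UY by auto
  ultimately show ?thesis by simp
qed

text \<open>
  What is needed of the Mayer-Vietoris sequence of an open cover \<open>A\<close>, \<open>U\<close>, without constructing it:
  excision identifies \<open>H(Y, A)\<close> with \<open>H(U, U \<inter> A)\<close>, and the long exact sequences of these two pairs
  are combined. If the homology of \<open>A\<close>, \<open>U\<close> and \<open>U \<inter> A\<close> vanishes above degree \<open>d\<close>, then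
  \<open>H_(d+1)(Y)\<close> embeds into \<open>H_d(U \<inter> A)\<close>, and the rank of the quotient by it is at most the sum
  of the ranks of \<open>H_d(A)\<close> and \<open>H_d(U)\<close>.
\<close>

lemma
  assumes op: "openin Y A" "openin Y U" "A \<union> U = topspace Y"
    and vanish: "\<And>p. p > d \<Longrightarrow> trivial_group (homology_group p (subtopology Y A))"
                "\<And>p. p > d \<Longrightarrow> trivial_group (homology_group p (subtopology Y U))"
                "\<And>p. p > d \<Longrightarrow> trivial_group (homology_group p (subtopology Y (U \<inter> A)))"
  shows homology_open_cover_vanish:
          "\<And>p. p > d + 1 \<Longrightarrow> trivial_group (homology_group p Y)"
    and homology_open_cover_upper:
          "int_rank (homology_group (d + 1) Y) \<le> int_rank (homology_group d (subtopology Y (U \<inter> A)))"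
    and homology_open_cover_lower:
          "int_rank (homology_group d (subtopology Y (U \<inter> A)))
             \<le> int_rank (homology_group (d + 1) Y) + int_rank (homology_group d (subtopology Y A))
                + int_rank (homology_group d (subtopology Y U))"
proof -
  let ?U = "subtopology Y U"
  have sub: "subtopology ?U (U \<inter> A) = subtopology Y (U \<inter> A)"
    by (simp add: subtopology_subtopology)
  note exc = excision_open_cover[OF op]
  have rk: "int_rank (relative_homology_group p Y A) = int_rank (relative_homology_group p ?U (U \<inter> A))" for p
    by (rule int_rank_iso[OF abelian_relative_homology_group abelian_relative_homology_group exc, symmetric])
  show "trivial_group (homology_group p Y)" if "p > d + 1" for p
  proof -
    have "trivial_group (relative_homology_group p ?U (U \<inter> A))"
    proof (rule trivial_homology_pair)
      show "trivial_group (homology_group p ?U)" using that by (intro vanish) simp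
      show "trivial_group (homology_group (p - 1) (subtopology ?U (U \<inter> A)))"
        unfolding sub using that by (intro vanish) simp
    qed
    then have "trivial_group (relative_homology_group p Y A)"
      by (rule isomorphic_group_triviality1[OF exc group_relative_homology_group])
    moreover have "trivial_group (homology_group p (subtopology Y A))"
      using that by (intro vanish) simp
    ultimately show ?thesis by (metis trivial_homology_space)
  qed
  have z: "int_rank (homology_group (d + 1) (subtopology Y A)) = 0"
       "int_rank (homology_group (d + 1) ?U) = 0"
    by (intro int_rank_trivial_group vanish; simp)+
  show "int_rank (homology_group (d + 1) Y) \<le> int_rank (homology_group d (subtopology Y (U \<inter> A)))"
    using int_rank_homology_space[of "d + 1" Y A] int_rank_homology_pair[of "d + 1" ?U "U \<inter> A"]
    by (simp add: z rk sub)
  have "int_rank (homology_group d (subtopology Y (U \<inter> A)))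
      \<le> int_rank (relative_homology_group (d + 1) Y A) + int_rank (homology_group d ?U)"
    using int_rank_homology_subspace[of "d + 1" ?U "U \<inter> A"] by (simp add: rk sub)
  also have "\<dots> \<le> (int_rank (homology_group (d + 1) Y) + int_rank (homology_group d (subtopology Y A)))
      + int_rank (homology_group d ?U)"
    using int_rank_homology_pair[of "d + 1" Y A] by (intro add_right_mono) simp
  finally show "int_rank (homology_group d (subtopology Y (U \<inter> A)))
             \<le> int_rank (homology_group (d + 1) Y) + int_rank (homology_group d (subtopology Y A))
                + int_rank (homology_group d ?U)" .
qed

lemma homology_disjoint_open_union2:
  assumes "openin Y S" "openin Y T" "disjnt S T"
  shows "DirProd (homology_group p (subtopology Y S)) (homology_group p (subtopology Y T))
           \<cong> homology_group p (subtopology Y (S \<union> T))"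
proof -
  have ST: "S \<subseteq> topspace Y" "T \<subseteq> topspace Y" using assms by (auto dest: openin_subset)
  let ?Z = "subtopology Y (S \<union> T)"
  have "openin ?Z S" "openin ?Z T"
    using assms by (auto simp: openin_subtopology)
  moreover have "S \<union> T = topspace ?Z" using ST by auto
  ultimately have "DirProd (homology_group p (subtopology ?Z S)) (homology_group p (subtopology ?Z T))
       \<cong> homology_group p ?Z"
    using homology_additivity_explicit[of ?Z S T p] assms(3) unfolding is_iso_def by blast
  moreover have "subtopology ?Z S = subtopology Y S" "subtopology ?Z T = subtopology Y T"
    by (simp_all add: subtopology_subtopology Int_absorb1)
  ultimately show ?thesis by simp
qed

lemma
  assumes "finite J" "\<And>j. j \<in> J \<Longrightarrow> openin Y (S j)"
    and "\<And>i j. i \<in> J \<Longrightarrow> j \<in> J \<Longrightarrow> i \<noteq> j \<Longrightarrow> disjnt (S i) (S j)"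
  shows int_rank_homology_disjoint_union:
      "int_rank (homology_group p (subtopology Y (\<Union>j\<in>J. S j)))
        = (\<Sum>j\<in>J. int_rank (homology_group p (subtopology Y (S j))))" (is ?rank)
    and trivial_homology_disjoint_union:
      "(\<And>j. j \<in> J \<Longrightarrow> trivial_group (homology_group p (subtopology Y (S j)))) \<Longrightarrow>
         trivial_group (homology_group p (subtopology Y (\<Union>j\<in>J. S j)))" (is "PROP ?triv")
proof -
  have "?rank \<and> ((\<forall>j\<in>J. trivial_group (homology_group p (subtopology Y (S j)))) \<longrightarrow>
         trivial_group (homology_group p (subtopology Y (\<Union>j\<in>J. S j))))"
    using assms
  proof (induction J rule: finite_induct)
    case empty
    have "trivial_group (homology_group p (subtopology Y {}))"
      by (intro trivial_homology_group_empty) auto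
    then show ?case by (simp add: int_rank_trivial_group)
  next
    case (insert j J)
    have iso: "DirProd (homology_group p (subtopology Y (S j))) (homology_group p (subtopology Y (\<Union>j\<in>J. S j)))
           \<cong> homology_group p (subtopology Y (\<Union>j\<in>insert j J. S j))"
      using homology_disjoint_open_union2[of Y "S j" "\<Union>j\<in>J. S j" p] insert
      by (auto simp: disjnt_def)
    have "int_rank (homology_group p (subtopology Y (\<Union>j\<in>insert j J. S j)))
        = int_rank (DirProd (homology_group p (subtopology Y (S j))) (homology_group p (subtopology Y (\<Union>j\<in>J. S j))))"
      by (rule int_rank_iso[OF comm_group_DirProd _ iso, symmetric]) auto
    moreover have "trivial_group (DirProd (homology_group p (subtopology Y (S j))) (homology_group p (subtopology Y (\<Union>j\<in>J. S j))))"
      if "trivial_group (homology_group p (subtopology Y (S j)))"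
         "trivial_group (homology_group p (subtopology Y (\<Union>j\<in>J. S j)))"
      using that by (auto simp: trivial_group_def DirProd_group)
    ultimately show ?case
      using insert isomorphic_group_triviality1[OF iso] by (simp add: int_rank_DirProd)
  qed
  then show ?rank "PROP ?triv" by auto
qed

lemma
  assumes "Y homotopy_equivalent_space Z"
  shows int_rank_homology_homotopy_equivalent:
      "int_rank (homology_group p Y) = int_rank (homology_group p Z)"
    and trivial_homology_homotopy_equivalent:
      "trivial_group (homology_group p Y) \<longleftrightarrow> trivial_group (homology_group p Z)"
proof -
  note iso = homotopy_equivalent_space_imp_isomorphic_homology_groups[OF assms, of p]
  show "int_rank (homology_group p Y) = int_rank (homology_group p Z)"
    by (rule int_rank_iso[OF abelian_relative_homology_group abelian_relative_homology_group iso])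
  show "trivial_group (homology_group p Y) \<longleftrightarrow> trivial_group (homology_group p Z)"
    by (rule isomorphic_group_triviality[OF iso group_relative_homology_group group_relative_homology_group])
qed

lemma
  assumes "finite (topspace Y)" "\<And>S. S \<subseteq> topspace Y \<Longrightarrow> openin Y S"
  shows int_rank_homology_finite_discrete: "int_rank (homology_group 0 Y) = enat (card (topspace Y))"
    and trivial_homology_finite_discrete: "p \<noteq> 0 \<Longrightarrow> trivial_group (homology_group p Y)"
proof -
  have eq: "subtopology Y (\<Union>y\<in>topspace Y. {y}) = Y"
    by (simp add: subtopology_superset)
  have pt: "topspace (subtopology Y {y}) = {y}" if "y \<in> topspace Y" for y using that by auto
  have "int_rank (homology_group 0 (subtopology Y {y})) = 1" if "y \<in> topspace Y" for y
    using int_rank_iso[OF abelian_relative_homology_group abelian_integer_group homology_coefficients[OF pt[OF that]]]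
    by (simp add: int_rank_integer_group)
  then show "int_rank (homology_group 0 Y) = enat (card (topspace Y))"
    using int_rank_homology_disjoint_union[of "topspace Y" Y "\<lambda>y. {y}" 0] assms
    by (simp add: of_nat_eq_enat subtopology_superset)
  show "trivial_group (homology_group p Y)" if "p \<noteq> 0"
    using trivial_homology_disjoint_union[of "topspace Y" Y "\<lambda>y. {y}" p] assms
      homology_dimension_axiom[OF pt that] by (simp add: subtopology_superset)
qed

section \<open>Sink configurations along one edge\<close>

lemma homotopy_equivalent_spaceI_deformation:
  assumes G: "continuous_map (prod_topology (top_of_set {0..1::real}) P) P G"
    and r: "continuous_map P W r" and s: "continuous_map W P s"
    and G0: "\<And>x. x \<in> topspace P \<Longrightarrow> G (0, x) = x"
    and G1: "\<And>x. x \<in> topspace P \<Longrightarrow> G (1, x) = s (r x)"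
    and rs: "\<And>y. y \<in> topspace W \<Longrightarrow> r (s y) = y"
  shows "P homotopy_equivalent_space W"
  unfolding homotopy_equivalent_space_def
proof (intro exI conjI)
  have "homotopic_with (\<lambda>_. True) P P id (s \<circ> r)"
    using G G0 G1 by (subst homotopic_with) auto
  then show "homotopic_with (\<lambda>_. True) P P (s \<circ> r) id"
    by (rule homotopic_with_symD)
  show "homotopic_with (\<lambda>_. True) W W (r \<circ> s) id"
    using rs r s by (intro homotopic_with_equal) (auto intro: continuous_map_compose)
qed (use r s in auto)

text \<open>
  The particles are labelled by an arbitrary set, because the induction over the edges removes one
  particle at a time and has to leave the labels of the others alone.
\<close>

definition sink_conf :: "'i set \<Rightarrow> 'a topology \<Rightarrow> 'a set \<Rightarrow> ('i \<Rightarrow> 'a) topology" where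
  "sink_conf I Z V =
     subtopology (product_topology (\<lambda>_. Z) I)
       {x. \<forall>i\<in>I. \<forall>j\<in>I. i \<noteq> j \<longrightarrow> x i = x j \<longrightarrow> x i \<in> V}"

lemma conf_sink_eq_sink_conf: "conf_sink n X V = sink_conf {1..n} X V"
proof -
  have "{x. \<forall>i\<in>{1..n}. \<forall>j\<in>{1..n}. i \<noteq> j \<longrightarrow> x i \<noteq> x j \<or> (x i = x j \<and> x i \<in> V)}
      = {x. \<forall>i\<in>{1..n}. \<forall>j\<in>{1..n}. i \<noteq> j \<longrightarrow> x i = x j \<longrightarrow> x i \<in> V}"
    by blast
  then show ?thesis unfolding conf_sink_def sink_conf_def by simp
qed

lemma topspace_sink_conf:
  "topspace (sink_conf I Z V) =
     {x \<in> I \<rightarrow>\<^sub>E topspace Z. \<forall>i\<in>I. \<forall>j\<in>I. i \<noteq> j \<longrightarrow> x i = x j \<longrightarrow> x i \<in> V}"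
  by (auto simp: sink_conf_def)

lemma continuous_map_sink_conf_coordinate:
  "i \<in> I \<Longrightarrow> continuous_map (sink_conf I Z V) Z (\<lambda>x. x i)"
  unfolding sink_conf_def by (intro continuous_map_from_subtopology continuous_map_product_projection)

lemma continuous_map_into_sink_conf:
  assumes "\<And>i. i \<in> I \<Longrightarrow> continuous_map P Z (\<lambda>x. f x i)"
    and "\<And>x. x \<in> topspace P \<Longrightarrow> f x \<in> extensional I"
    and "\<And>x i j. x \<in> topspace P \<Longrightarrow> i \<in> I \<Longrightarrow> j \<in> I \<Longrightarrow> i \<noteq> j \<Longrightarrow> f x i = f x j \<Longrightarrow> f x i \<in> V"
  shows "continuous_map P (sink_conf I Z V) f"
  unfolding sink_conf_def continuous_map_in_subtopology continuous_map_componentwise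
  using assms by auto

text \<open>
  A space \<open>Z\<close> that consists of a subspace \<open>Z\<^sub>0\<close> and one open edge with coordinate \<open>h\<close> and
  parametrisation \<open>\<phi>\<close>. The function \<open>\<delta>\<close> is the distance from the midpoint of the edge, extended by
  its maximal value \<open>1/2\<close> to \<open>Z\<^sub>0\<close>. The homotopy \<open>K\<close> lives on the complement of the midpoint and pushes
  both halves of the edge outwards into the end points. Two properties make it act on
  configurations: particles that get stuck together do so in \<open>V\<close> only, and \<open>\<delta>\<close> grows in a way that
  depends on \<open>\<delta>\<close> alone, so the order of the particles by distance from the midpoint is preserved until
  the end.
\<close>

locale edge_deformation =
  fixes Z :: "'a topology" and Z\<^sub>0 V :: "'a set" and \<delta> h :: "'a \<Rightarrow> real"
    and \<phi> :: "real \<Rightarrow> 'a" and K :: "real \<times> 'a \<Rightarrow> 'a"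
  assumes V_subset: "V \<subseteq> Z\<^sub>0"
    and Z0_subset: "Z\<^sub>0 \<subseteq> topspace Z"
    and \<delta>_continuous: "continuous_map Z euclideanreal \<delta>"
    and \<delta>_bounds: "\<And>z. z \<in> topspace Z \<Longrightarrow> 0 \<le> \<delta> z \<and> \<delta> z \<le> 1/2"
    and \<delta>_half_iff: "\<And>z. z \<in> topspace Z \<Longrightarrow> \<delta> z = 1/2 \<longleftrightarrow> z \<in> Z\<^sub>0"
    and h_continuous: "continuous_map (subtopology Z {z. \<delta> z < 1/2}) euclideanreal h"
    and \<phi>_continuous: "continuous_map (top_of_set {0<..<1}) Z \<phi>"
    and \<phi>_coordinate: "\<And>t. 0 < t \<Longrightarrow> t < 1 \<Longrightarrow> \<delta> (\<phi> t) = \<bar>t - 1/2\<bar> \<and> h (\<phi> t) = t"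
    and coordinate: "\<And>z. z \<in> topspace Z \<Longrightarrow> \<delta> z < 1/2 \<Longrightarrow> 0 < h z \<and> h z < 1 \<and> \<phi> (h z) = z"
    and K_continuous:
      "continuous_map (prod_topology (top_of_set {0..1}) (subtopology Z {z. \<delta> z > 0})) Z K"
    and K_0: "\<And>z. z \<in> topspace Z \<Longrightarrow> \<delta> z > 0 \<Longrightarrow> K (0, z) = z"
    and K_fixed: "\<And>\<tau> z. z \<in> Z\<^sub>0 \<Longrightarrow> \<tau> \<in> {0..1} \<Longrightarrow> K (\<tau>, z) = z"
    and K_\<delta>: "\<And>\<tau> z. z \<in> topspace Z \<Longrightarrow> \<delta> z > 0 \<Longrightarrow> \<tau> \<in> {0..1} \<Longrightarrow>
                  \<delta> (K (\<tau>, z)) = \<tau> / 2 + (1 - \<tau>) * \<delta> z"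
    and K_into_V: "\<And>\<tau> z. z \<in> topspace Z \<Longrightarrow> \<delta> z > 0 \<Longrightarrow> \<tau> \<in> {0..1} \<Longrightarrow> z \<notin> Z\<^sub>0 \<Longrightarrow>
                  K (\<tau>, z) \<in> Z\<^sub>0 \<Longrightarrow> K (\<tau>, z) \<in> V"
    and K_inj: "\<And>\<tau> z w. z \<in> topspace Z \<Longrightarrow> \<delta> z > 0 \<Longrightarrow> w \<in> topspace Z \<Longrightarrow> \<delta> w > 0 \<Longrightarrow>
                  \<tau> \<in> {0..1} \<Longrightarrow> K (\<tau>, z) \<notin> Z\<^sub>0 \<Longrightarrow> K (\<tau>, z) = K (\<tau>, w) \<Longrightarrow> z = w"
begin

lemma \<delta>_eq_abs: "z \<in> topspace Z \<Longrightarrow> \<delta> z < 1/2 \<Longrightarrow> \<delta> z = \<bar>h z - 1/2\<bar>"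
  using coordinate[of z] \<phi>_coordinate[of "h z"] by auto

lemma \<phi>_in: "0 < t \<Longrightarrow> t < 1 \<Longrightarrow> \<phi> t \<in> topspace Z"
  using \<phi>_continuous by (auto simp: continuous_map_def Pi_def)

lemma K_in: "z \<in> topspace Z \<Longrightarrow> \<delta> z > 0 \<Longrightarrow> \<tau> \<in> {0..1} \<Longrightarrow> K (\<tau>, z) \<in> topspace Z"
  using K_continuous by (auto simp: continuous_map_def Pi_def)

lemma K_1: "z \<in> topspace Z \<Longrightarrow> \<delta> z > 0 \<Longrightarrow> K (1, z) \<in> Z\<^sub>0"
  using K_\<delta>[of z 1] K_in[of z 1] \<delta>_half_iff[of "K (1, z)"] by auto

text \<open>
  Pushing does not create forbidden collisions: \<open>K\<close> is injective as long as the image lies in the open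
  edge, and whatever leaves the edge does so into \<open>V\<close>.
\<close>

lemma K_collision:
  assumes "z \<in> topspace Z" "\<delta> z > 0" "w \<in> topspace Z" "\<delta> w > 0" "\<tau> \<in> {0..1}"
    and eq: "K (\<tau>, z) = K (\<tau>, w)" and V: "z = w \<Longrightarrow> z \<in> V"
  shows "K (\<tau>, z) \<in> V"
proof (cases "K (\<tau>, z) \<in> Z\<^sub>0")
  case True
  then show ?thesis
    using assms K_into_V[of z \<tau>] K_into_V[of w \<tau>] K_fixed[of z \<tau>] K_fixed[of w \<tau>] by metis
next
  case False
  then have "z = w" using assms K_inj by blast
  then have "z \<in> Z\<^sub>0" using V V_subset by auto
  then show ?thesis using K_fixed[of z \<tau>] assms False by auto
qed

text \<open>
  The open cover of the configuration space that removes the edge. In \<open>avoid I\<close> no particle sits at the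
  midpoint. In \<open>near I i T\<close> particle \<open>i\<close> is on the edge, strictly closer to the midpoint than all other
  particles, with its coordinate in \<open>T\<close>. Only one particle can be at the midpoint, so these sets cover.
\<close>

definition avoid :: "'i set \<Rightarrow> ('i \<Rightarrow> 'a) set" where
  "avoid I = {x \<in> topspace (sink_conf I Z V). \<forall>i\<in>I. \<delta> (x i) > 0}"

definition near :: "'i set \<Rightarrow> 'i \<Rightarrow> real set \<Rightarrow> ('i \<Rightarrow> 'a) set" where
  "near I i T = {x \<in> topspace (sink_conf I Z V).
     \<delta> (x i) < 1/2 \<and> (\<forall>j\<in>I - {i}. \<delta> (x i) < \<delta> (x j)) \<and> h (x i) \<in> T}"

lemma continuous_map_\<delta>_coordinate:
  "i \<in> I \<Longrightarrow> continuous_map (sink_conf I Z V) euclideanreal (\<lambda>x. \<delta> (x i))"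
  using continuous_map_compose[OF continuous_map_sink_conf_coordinate \<delta>_continuous, of i I V]
  by (simp add: o_def)

lemma openin_avoid:
  assumes "finite I"
  shows "openin (sink_conf I Z V) (avoid I)"
proof -
  let ?Y = "sink_conf I Z V"
  have "openin ?Y {x \<in> topspace ?Y. \<delta> (x i) \<in> {0<..}}" if "i \<in> I" for i
    using continuous_map_\<delta>_coordinate[OF that] by (rule openin_continuous_map_preimage) auto
  then have "openin ?Y ((\<Inter>i\<in>I. {x \<in> topspace ?Y. \<delta> (x i) \<in> {0<..}}) \<inter> topspace ?Y)"
    using assms by (intro openin_INT) auto
  moreover have "(\<Inter>i\<in>I. {x \<in> topspace ?Y. \<delta> (x i) \<in> {0<..}}) \<inter> topspace ?Y = avoid I"
    by (auto simp: avoid_def)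
  ultimately show ?thesis by simp
qed

lemma openin_near:
  assumes "finite I" "i \<in> I" "open T"
  shows "openin (sink_conf I Z V) (near I i T)"
proof -
  let ?Y = "sink_conf I Z V"
  define D where "D = {x \<in> topspace ?Y. \<delta> (x i) < 1/2}"
  have "openin ?Y {x \<in> topspace ?Y. \<delta> (x i) \<in> {..<1/2}}"
    using continuous_map_\<delta>_coordinate[OF assms(2)] by (rule openin_continuous_map_preimage) auto
  then have D: "openin ?Y D" by (simp add: D_def)
  have "continuous_map (subtopology ?Y D) (subtopology Z {z. \<delta> z < 1/2}) (\<lambda>x. x i)"
    unfolding continuous_map_in_subtopology
    using continuous_map_from_subtopology[OF continuous_map_sink_conf_coordinate[OF assms(2)]]
    by (auto simp: D_def)
  from continuous_map_compose[OF this h_continuous]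
  have "continuous_map (subtopology ?Y D) euclideanreal (\<lambda>x. h (x i))" by (simp add: o_def)
  then have "openin (subtopology ?Y D) {x \<in> topspace (subtopology ?Y D). h (x i) \<in> T}"
    using assms(3) by (intro openin_continuous_map_preimage) auto
  then have 1: "openin ?Y {x \<in> topspace (subtopology ?Y D). h (x i) \<in> T}"
    using D by (rule openin_trans_full)
  have "openin ?Y {x \<in> topspace ?Y. \<delta> (x j) - \<delta> (x i) \<in> {0<..}}" if "j \<in> I" for j
    using continuous_map_\<delta>_coordinate[OF that] continuous_map_\<delta>_coordinate[OF assms(2)]
    by (intro openin_continuous_map_preimage[where Y = euclideanreal] continuous_map_diff) auto
  then have 2: "openin ?Y ((\<Inter>j\<in>I-{i}. {x \<in> topspace ?Y. \<delta> (x j) - \<delta> (x i) \<in> {0<..}}) \<inter> topspace ?Y)"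
    using assms by (intro openin_INT) auto
  have "near I i T = {x \<in> topspace (subtopology ?Y D). h (x i) \<in> T} \<inter>
      ((\<Inter>j\<in>I-{i}. {x \<in> topspace ?Y. \<delta> (x j) - \<delta> (x i) \<in> {0<..}}) \<inter> topspace ?Y)"
    by (auto simp: near_def D_def)
  then show ?thesis using openin_Int[OF 1 2] by simp
qed

lemma continuous_map_K_coordinate:
  assumes j: "j \<in> I" and S: "\<And>x. x \<in> S \<Longrightarrow> \<delta> (x j) > 0"
  shows "continuous_map (prod_topology (top_of_set {0..1}) (subtopology (sink_conf I Z V) S)) Z
           (\<lambda>y. K (fst y, snd y j))"
proof -
  let ?P = "subtopology (sink_conf I Z V) S"
  have "continuous_map ?P (subtopology Z {z. \<delta> z > 0}) (\<lambda>x. x j)"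
    unfolding continuous_map_in_subtopology
    using continuous_map_from_subtopology[OF continuous_map_sink_conf_coordinate[OF j]] S by auto
  then have "continuous_map (prod_topology (top_of_set {0..1}) ?P)
      (prod_topology (top_of_set {0..1}) (subtopology Z {z. \<delta> z > 0})) (\<lambda>y. (fst y, snd y j))"
    using continuous_map_compose[OF continuous_map_snd, of ?P _ "\<lambda>x. x j"]
    by (intro continuous_map_pairedI) (auto simp: continuous_map_fst o_def)
  from continuous_map_compose[OF this K_continuous] show ?thesis by (simp add: o_def)
qed

lemma continuous_map_K_1_coordinate:
  assumes j: "j \<in> I" and S: "\<And>x. x \<in> S \<Longrightarrow> \<delta> (x j) > 0"
  shows "continuous_map (subtopology (sink_conf I Z V) S) (subtopology Z Z\<^sub>0) (\<lambda>x. K (1, x j))"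
proof -
  let ?P = "subtopology (sink_conf I Z V) S"
  have "continuous_map ?P (prod_topology (top_of_set {0..1}) ?P) (\<lambda>x. (1::real, x))"
    by (intro continuous_map_pairedI) auto
  from continuous_map_compose[OF this continuous_map_K_coordinate[OF j, of S]]
  have "continuous_map ?P Z (\<lambda>x. K (1, x j))" using S by (simp add: o_def)
  moreover have "K (1, x j) \<in> Z\<^sub>0" if "x \<in> topspace ?P" for x
    using that j S by (intro K_1) (auto simp: topspace_sink_conf)
  ultimately show ?thesis by (auto simp: continuous_map_in_subtopology)
qed

text \<open>
  Once nobody occupies the midpoint, the whole edge can be emptied by applying \<open>K\<close> to all particles
  simultaneously.
\<close>

lemma sink_conf_avoid_homotopy_equivalent:
  "subtopology (sink_conf I Z V) (avoid I) homotopy_equivalent_space sink_conf I (subtopology Z Z\<^sub>0) V"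
proof -
  let ?P = "subtopology (sink_conf I Z V) (avoid I)"
  let ?G = "\<lambda>y. \<lambda>j\<in>I. K (fst y, snd y j)"
  have P: "x i \<in> topspace Z" "\<delta> (x i) > 0" "i \<noteq> j \<Longrightarrow> x i = x j \<Longrightarrow> x i \<in> V"
    if "x \<in> avoid I" "i \<in> I" "j \<in> I" for x i j
    using that unfolding avoid_def topspace_sink_conf by auto
  show ?thesis
  proof (rule homotopy_equivalent_spaceI_deformation)
    show "continuous_map (prod_topology (top_of_set {0..1}) ?P) ?P ?G"
      unfolding continuous_map_in_subtopology
    proof
      show cont: "continuous_map (prod_topology (top_of_set {0..1}) ?P) (sink_conf I Z V) ?G"
      proof (rule continuous_map_into_sink_conf)
        show "continuous_map (prod_topology (top_of_set {0..1}) ?P) Z (\<lambda>y. ?G y i)" if "i \<in> I" for i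
          using continuous_map_K_coordinate[of i I "avoid I"] that by (simp add: avoid_def)
        fix y i j assume "y \<in> topspace (prod_topology (top_of_set {0..1}) ?P)" "i \<in> I" "j \<in> I" "i \<noteq> j"
          "?G y i = ?G y j"
        then show "?G y i \<in> V" using P by (auto intro!: K_collision)
      qed auto
      show "?G \<in> topspace (prod_topology (top_of_set {0..1}) ?P) \<rightarrow> avoid I"
      proof
        fix y :: "real \<times> _" assume y: "y \<in> topspace (prod_topology (top_of_set {0..1}) ?P)"
        then have "?G y \<in> topspace (sink_conf I Z V)"
          using cont by (auto simp: continuous_map_def Pi_def)
        moreover have "\<delta> (K (fst y, snd y i)) > 0" if "i \<in> I" for i
          using y that P[of "snd y" i] K_\<delta>[of "snd y i" "fst y"]
          by (cases "fst y = 1") (auto intro!: add_nonneg_pos)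
        ultimately show "?G y \<in> avoid I" by (simp add: avoid_def)
      qed
    qed
    show "continuous_map ?P (sink_conf I (subtopology Z Z\<^sub>0) V) (\<lambda>x. \<lambda>j\<in>I. K (1, x j))"
    proof (rule continuous_map_into_sink_conf)
      show "continuous_map ?P (subtopology Z Z\<^sub>0) (\<lambda>x. (\<lambda>j\<in>I. K (1, x j)) i)" if "i \<in> I" for i
        using continuous_map_K_1_coordinate[of i I "avoid I"] that by (simp add: avoid_def)
      fix x i j assume "x \<in> topspace ?P" "i \<in> I" "j \<in> I" "i \<noteq> j" "(\<lambda>j\<in>I. K (1, x j)) i = (\<lambda>j\<in>I. K (1, x j)) j"
      then show "(\<lambda>j\<in>I. K (1, x j)) i \<in> V" using P by (auto intro!: K_collision)
    qed auto
    have W: "x \<in> topspace (sink_conf I Z V)" "x i \<in> Z\<^sub>0" if "x \<in> topspace (sink_conf I (subtopology Z Z\<^sub>0) V)" "i \<in> I" for x i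
      using that by (auto simp: topspace_sink_conf PiE_iff)
    have sub: "x \<in> avoid I" if "x \<in> topspace (sink_conf I (subtopology Z Z\<^sub>0) V)" for x
    proof -
      have "x \<in> topspace (sink_conf I Z V)" using that by (auto simp: topspace_sink_conf PiE_iff)
      moreover have "\<delta> (x i) > 0" if "i \<in> I" for i
        using W[OF \<open>x \<in> topspace (sink_conf I (subtopology Z Z\<^sub>0) V)\<close> that] Z0_subset \<delta>_half_iff[of "x i"] by auto
      ultimately show ?thesis by (simp add: avoid_def)
    qed
    have "continuous_map (sink_conf I (subtopology Z Z\<^sub>0) V) (sink_conf I Z V) id"
    proof (rule continuous_map_into_sink_conf)
      show "continuous_map (sink_conf I (subtopology Z Z\<^sub>0) V) Z (\<lambda>x. id x i)" if "i \<in> I" for i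
        using continuous_map_sink_conf_coordinate[OF that, of "subtopology Z Z\<^sub>0" V]
        by (auto simp: continuous_map_in_subtopology)
    qed (auto simp: topspace_sink_conf PiE_iff)
    then show "continuous_map (sink_conf I (subtopology Z Z\<^sub>0) V) ?P id"
      using sub by (auto simp: continuous_map_in_subtopology)
    show "?G (0, x) = x" if "x \<in> topspace ?P" for x
    proof
      show "?G (0, x) i = x i" for i
        using that P[of x i] K_0 by (auto simp: avoid_def topspace_sink_conf)
    qed
    show "?G (1, x) = id (\<lambda>j\<in>I. K (1, x j))" for x by simp
    show "(\<lambda>j\<in>I. K (1, id y j)) = y" if "y \<in> topspace (sink_conf I (subtopology Z Z\<^sub>0) V)" for y
    proof
      show "(\<lambda>j\<in>I. K (1, id y j)) i = y i" for i
        using that W(2)[of y i] K_fixed[of "y i" 1] by (auto simp: topspace_sink_conf)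
    qed
  qed
qed


text \<open>
  Particle \<open>i\<close> slides to a fixed position \<open>c\<close> of \<open>T\<close> while \<open>K\<close> pushes all others off the edge. What is
  left is a configuration of the others outside the edge. Both motions are linear in the coordinate,
  hence particle \<open>i\<close> remains strictly closest to the midpoint throughout.
\<close>

lemma sink_conf_near_homotopy_equivalent:
  assumes i: "i \<in> I" and c: "c \<in> T" and T: "T \<subseteq> {0<..<1}" "convex T"
  shows "subtopology (sink_conf I Z V) (near I i T) homotopy_equivalent_space
           sink_conf (I - {i}) (subtopology Z Z\<^sub>0) V"
proof -
  let ?P = "subtopology (sink_conf I Z V) (near I i T)"
  let ?W = "sink_conf (I - {i}) (subtopology Z Z\<^sub>0) V"
  let ?m = "\<lambda>y :: real \<times> _. (1 - fst y) * h (snd y i) + fst y * c"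
  let ?G = "\<lambda>y. \<lambda>j\<in>I. if j = i then \<phi> (?m y) else K (fst y, snd y j)"
  let ?s = "\<lambda>y. \<lambda>j\<in>I. if j = i then \<phi> c else y j"
  have c01: "0 < c" "c < 1" using c T by auto
  have abs_half: "\<bar>t - 1/2\<bar> < 1/2" if "0 < t" "t < 1" for t :: real using that by linarith
  have P: "x j \<in> topspace Z" "j \<noteq> i \<Longrightarrow> \<delta> (x j) > \<delta> (x i)" "j \<noteq> i \<Longrightarrow> \<delta> (x j) > 0"
      "\<And>k. k \<in> I \<Longrightarrow> j \<noteq> k \<Longrightarrow> x j = x k \<Longrightarrow> x j \<in> V"
    if "x \<in> near I i T" "j \<in> I" for x j
  proof -
    show "x j \<in> topspace Z" "\<And>k. k \<in> I \<Longrightarrow> j \<noteq> k \<Longrightarrow> x j = x k \<Longrightarrow> x j \<in> V"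
      using that unfolding near_def topspace_sink_conf by auto
    show *: "\<delta> (x j) > \<delta> (x i)" if "j \<noteq> i"
      using that \<open>x \<in> near I i T\<close> \<open>j \<in> I\<close> unfolding near_def by auto
    have "x i \<in> topspace Z"
      using \<open>x \<in> near I i T\<close> i unfolding near_def topspace_sink_conf by auto
    then show "\<delta> (x j) > 0" if "j \<noteq> i" using *[OF that] \<delta>_bounds[of "x i"] by simp
  qed
  have Pi: "x i \<in> topspace Z" "\<delta> (x i) < 1/2" "h (x i) \<in> T" "\<phi> (h (x i)) = x i"
      "\<delta> (x i) = \<bar>h (x i) - 1/2\<bar>" if "x \<in> near I i T" for x
  proof -
    show 1: "x i \<in> topspace Z" using P(1)[OF that i] .
    show 2: "\<delta> (x i) < 1/2" and "h (x i) \<in> T" using that by (auto simp: near_def)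
    show "\<phi> (h (x i)) = x i" "\<delta> (x i) = \<bar>h (x i) - 1/2\<bar>"
      using coordinate[OF 1 2] \<delta>_eq_abs[OF 1 2] by auto
  qed
  have m: "?m y \<in> T" "0 < ?m y" "?m y < 1" if "fst y \<in> {0..1}" "snd y \<in> near I i T" for y
  proof -
    show "?m y \<in> T"
      using convexD[OF T(2) Pi(3)[OF that(2)] c, of "1 - fst y" "fst y"] that by simp
    then show "0 < ?m y" "?m y < 1" using T by auto
  qed
  \<comment> \<open>The distance of particle \<open>i\<close> is bounded by the interpolation between its old distance and
  that of \<open>c\<close>, which is below \<open>1/2\<close>; the others interpolate between a larger distance and \<open>1/2\<close>.\<close>
  have \<delta>m: "\<delta> (\<phi> (?m y)) < \<delta> (K (fst y, snd y j))"
    if "fst y \<in> {0..1}" "snd y \<in> near I i T" "j \<in> I" "j \<noteq> i" for y j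
  proof -
    let ?\<tau> = "fst y"
    have "?m y - 1/2 = (1 - ?\<tau>) * (h (snd y i) - 1/2) + ?\<tau> * (c - 1/2)"
      by (simp add: field_simps)
    then have "\<delta> (\<phi> (?m y)) = \<bar>(1 - ?\<tau>) * (h (snd y i) - 1/2) + ?\<tau> * (c - 1/2)\<bar>"
      using \<phi>_coordinate[OF m(2,3)[OF that(1,2)]] by simp
    also have "\<dots> \<le> (1 - ?\<tau>) * \<bar>h (snd y i) - 1/2\<bar> + ?\<tau> * \<bar>c - 1/2\<bar>"
      using that(1) by (intro order_trans[OF abs_triangle_ineq]) (simp add: abs_mult)
    also have "\<dots> = (1 - ?\<tau>) * \<delta> (snd y i) + ?\<tau> * \<bar>c - 1/2\<bar>"
      using Pi(5)[OF that(2)] by simp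
    also have "\<dots> < (1 - ?\<tau>) * \<delta> (snd y j) + ?\<tau> * (1/2)"
    proof (cases "?\<tau> = 0")
      case True
      then show ?thesis using P(2)[OF that(2,3,4)] by simp
    next
      case False
      have "?\<tau> * \<bar>c - 1/2\<bar> < ?\<tau> * (1/2)"
      proof (rule mult_strict_left_mono)
        show "\<bar>c - 1/2\<bar> < 1/2" using c01 by (rule abs_half)
        show "0 < ?\<tau>" using False that(1) by simp
      qed
      moreover have "(1 - ?\<tau>) * \<delta> (snd y i) \<le> (1 - ?\<tau>) * \<delta> (snd y j)"
        using P(2)[OF that(2,3,4)] that(1) by (intro mult_left_mono) auto
      ultimately show ?thesis by linarith
    qed
    also have "\<dots> = \<delta> (K (?\<tau>, snd y j))"
      using K_\<delta>[of "snd y j" ?\<tau>] P[OF that(2,3)] that by simp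
    finally show ?thesis .
  qed
  have cont_h: "continuous_map (prod_topology (top_of_set {0..1}) ?P) euclideanreal (\<lambda>y. h (snd y i))"
  proof -
    have "continuous_map ?P (subtopology Z {z. \<delta> z < 1/2}) (\<lambda>x. x i)"
      unfolding continuous_map_in_subtopology
      using continuous_map_from_subtopology[OF continuous_map_sink_conf_coordinate[OF i]] Pi(2) by auto
    from continuous_map_compose[OF continuous_map_compose[OF continuous_map_snd this] h_continuous]
    show ?thesis by (simp add: o_def)
  qed
  show ?thesis
  proof (rule homotopy_equivalent_spaceI_deformation)
    show "continuous_map (prod_topology (top_of_set {0..1}) ?P) ?P ?G"
      unfolding continuous_map_in_subtopology
    proof
      show cont: "continuous_map (prod_topology (top_of_set {0..1}) ?P) (sink_conf I Z V) ?G"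
      proof (rule continuous_map_into_sink_conf)
        show "continuous_map (prod_topology (top_of_set {0..1}) ?P) Z (\<lambda>y. ?G y j)" if j: "j \<in> I" for j
        proof (cases "j = i")
          case True
          have "continuous_map (prod_topology (top_of_set {0..1::real}) ?P) (top_of_set {0..1}) fst"
            by (rule continuous_map_fst)
          then have "continuous_map (prod_topology (top_of_set {0..1}) ?P) euclideanreal fst"
            by (rule continuous_map_into_fulltopology)
          then have "continuous_map (prod_topology (top_of_set {0..1}) ?P) euclideanreal ?m"
            by (intro continuous_map_add continuous_map_real_mult continuous_map_diff cont_h) auto
          then have "continuous_map (prod_topology (top_of_set {0..1}) ?P) (top_of_set {0<..<1}) ?m"
            using m by (auto simp: continuous_map_in_subtopology)
          from continuous_map_compose[OF this \<phi>_continuous] show ?thesis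
            using True j by (simp add: o_def)
        next
          case False
          then show ?thesis
            using continuous_map_K_coordinate[OF j, of "near I i T"] P j by simp
        qed
        fix y :: "real \<times> _" and j k
        assume y: "y \<in> topspace (prod_topology (top_of_set {0..1}) ?P)"
          and jk: "j \<in> I" "k \<in> I" "j \<noteq> k" "?G y j = ?G y k"
        then have "fst y \<in> {0..1}" "snd y \<in> near I i T" by auto
        note \<delta>my = \<delta>m[OF this] and y' = this
        have "j \<noteq> i" "k \<noteq> i" using \<delta>my[OF jk(1)] \<delta>my[OF jk(2)] jk by auto
        then show "?G y j \<in> V"
          using jk P(4)[OF y'(2) jk(1) jk(2)] P[OF y'(2) jk(1)] P[OF y'(2) jk(2)] y'
          by (auto intro!: K_collision)
      qed auto
      show "?G \<in> topspace (prod_topology (top_of_set {0..1}) ?P) \<rightarrow> near I i T"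
      proof
        fix y :: "real \<times> _" assume y: "y \<in> topspace (prod_topology (top_of_set {0..1}) ?P)"
        then have y': "fst y \<in> {0..1}" "snd y \<in> near I i T" by auto
        have "?G y \<in> topspace (sink_conf I Z V)"
          using cont y by (auto simp: continuous_map_def Pi_def)
        moreover have "\<delta> (\<phi> (?m y)) < 1/2" "h (\<phi> (?m y)) \<in> T"
          using \<phi>_coordinate[OF m(2,3)[OF y']] m(1)[OF y'] abs_half[OF m(2,3)[OF y']] by simp_all
        moreover have "\<forall>j\<in>I - {i}. \<delta> (\<phi> (?m y)) < \<delta> (K (fst y, snd y j))"
          using \<delta>m[OF y'] by blast
        moreover have "?G y i = \<phi> (?m y)" "\<forall>j\<in>I - {i}. ?G y j = K (fst y, snd y j)"
          using i by simp_all
        ultimately show "?G y \<in> near I i T" unfolding near_def by simp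
      qed
    qed
    show "continuous_map ?P ?W (\<lambda>x. \<lambda>j\<in>I-{i}. K (1, x j))"
    proof (rule continuous_map_into_sink_conf)
      show "continuous_map ?P (subtopology Z Z\<^sub>0) (\<lambda>x. (\<lambda>j\<in>I-{i}. K (1, x j)) j)" if "j \<in> I - {i}" for j
        using continuous_map_K_1_coordinate[of j I "near I i T"] that P by auto
      fix x j k assume "x \<in> topspace ?P" "j \<in> I - {i}" "k \<in> I - {i}" "j \<noteq> k"
        "(\<lambda>j\<in>I-{i}. K (1, x j)) j = (\<lambda>j\<in>I-{i}. K (1, x j)) k"
      then show "(\<lambda>j\<in>I-{i}. K (1, x j)) j \<in> V" using P by (auto intro!: K_collision)
    qed auto
    have W: "y j \<in> Z\<^sub>0" "y j \<in> topspace Z" "\<delta> (y j) = 1/2" if "y \<in> topspace ?W" "j \<in> I" "j \<noteq> i" for y j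
    proof -
      show "y j \<in> Z\<^sub>0" "y j \<in> topspace Z" using that by (auto simp: topspace_sink_conf PiE_iff)
      then show "\<delta> (y j) = 1/2" using \<delta>_half_iff by auto
    qed
    have \<phi>c: "\<delta> (\<phi> c) < 1/2" "h (\<phi> c) = c" using \<phi>_coordinate[OF c01] abs_half[OF c01] by simp_all
    show "continuous_map ?W ?P ?s"
      unfolding continuous_map_in_subtopology
    proof
      show cont: "continuous_map ?W (sink_conf I Z V) ?s"
      proof (rule continuous_map_into_sink_conf)
        show "continuous_map ?W Z (\<lambda>y. ?s y j)" if "j \<in> I" for j
        proof (cases "j = i")
          case True
          then show ?thesis using that \<phi>_in[OF c01] by simp
        next
          case False
          then show ?thesis
            using that continuous_map_sink_conf_coordinate[of j "I - {i}" "subtopology Z Z\<^sub>0" V]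
            by (auto simp: continuous_map_in_subtopology)
        qed
        fix y j k assume y: "y \<in> topspace ?W" and jk: "j \<in> I" "k \<in> I" "j \<noteq> k" "?s y j = ?s y k"
        have "y l \<noteq> \<phi> c" if "l \<in> I" "l \<noteq> i" for l
          using W(3)[OF y that] \<phi>c(1) by (metis less_irrefl)
        then have "j \<noteq> i" "k \<noteq> i" using jk by (auto split: if_splits)
        then show "?s y j \<in> V" using y jk by (auto simp: topspace_sink_conf)
      qed auto
      show "?s \<in> topspace ?W \<rightarrow> near I i T"
      proof
        fix y assume y: "y \<in> topspace ?W"
        have "?s y \<in> topspace (sink_conf I Z V)"
          using cont y by (auto simp: continuous_map_def Pi_def)
        moreover have "?s y i = \<phi> c" "\<forall>j\<in>I - {i}. ?s y j = y j" using i by simp_all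
        moreover have "\<forall>j\<in>I - {i}. \<delta> (\<phi> c) < \<delta> (y j)"
          using W(3)[OF y] \<phi>c(1) by (metis DiffE insertI1)
        ultimately show "?s y \<in> near I i T" unfolding near_def using \<phi>c c by simp
      qed
    qed
    show "?G (0, x) = x" if "x \<in> topspace ?P" for x
    proof
      have x: "x \<in> near I i T" using that by auto
      show "?G (0, x) j = x j" for j
        using that P[OF x, of j] Pi(4)[OF x] K_0[of "x j"] by (auto simp: topspace_sink_conf)
    qed
    show "?G (1, x) = ?s (\<lambda>j\<in>I-{i}. K (1, x j))" for x by auto
    show "(\<lambda>j\<in>I-{i}. K (1, ?s y j)) = y" if "y \<in> topspace ?W" for y
    proof
      show "(\<lambda>j\<in>I-{i}. K (1, ?s y j)) j = y j" for j
        using that W(1)[OF that, of j] K_fixed[of "y j" 1] by (auto simp: topspace_sink_conf)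
    qed
  qed
qed

lemma avoid_near_cover:
  "avoid I \<union> (\<Union>i\<in>I. near I i {0<..<1}) = topspace (sink_conf I Z V)"
proof (intro equalityI subsetI)
  fix x assume x: "x \<in> topspace (sink_conf I Z V)"
  show "x \<in> avoid I \<union> (\<Union>i\<in>I. near I i {0<..<1})"
  proof (cases "x \<in> avoid I")
    case False
    have xZ: "x j \<in> topspace Z" if "j \<in> I" for j using x that by (auto simp: topspace_sink_conf)
    obtain i where i: "i \<in> I" "\<delta> (x i) \<le> 0" using False x by (auto simp: avoid_def not_less)
    then have \<delta>i: "\<delta> (x i) = 0" using \<delta>_bounds[OF xZ[OF i(1)]] by auto
    have mid: "x j = \<phi> (1/2)" if "j \<in> I" "\<delta> (x j) = 0" for j
    proof -
      have "h (x j) = 1/2" using \<delta>_eq_abs[OF xZ[OF that(1)]] that by simp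
      moreover have "\<phi> (h (x j)) = x j" using coordinate[OF xZ[OF that(1)]] that by simp
      ultimately show ?thesis by metis
    qed
    \<comment> \<open>A second particle at the midpoint would collide with \<open>i\<close> outside \<open>V\<close>.\<close>
    have "\<delta> (x j) > 0" if j: "j \<in> I - {i}" for j
    proof (rule ccontr)
      assume "\<not> \<delta> (x j) > 0"
      then have "\<delta> (x j) = 0" using \<delta>_bounds[OF xZ, of j] j by auto
      then have "x j = x i" using mid[of j] mid[of i] j i \<delta>i by simp
      then have "x i \<in> V" using x i j by (auto simp: topspace_sink_conf)
      then have "\<delta> (x i) = 1/2" using V_subset \<delta>_half_iff[OF xZ[OF i(1)]] by auto
      then show False using \<delta>i by simp
    qed
    then have "x \<in> near I i {0<..<1}"
      using x \<delta>i coordinate[OF xZ[OF i(1)]] by (simp add: near_def)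
    then show ?thesis using i by auto
  qed auto
qed (auto simp: avoid_def near_def)

lemma disjnt_near:
  assumes "i \<in> I" "j \<in> I" "i \<noteq> j"
  shows "disjnt (near I i T) (near I j T')"
  unfolding disjnt_iff
proof (intro allI notI, elim conjE)
  fix x assume "x \<in> near I i T" "x \<in> near I j T'"
  then have "\<delta> (x i) < \<delta> (x j)" "\<delta> (x j) < \<delta> (x i)"
    using assms by (simp_all add: near_def)
  then show False by simp
qed

text \<open>
  Every particle other than \<open>i\<close> is off the midpoint anyway, so avoiding the midpoint means that \<open>i\<close> is
  on one of the two sides of it.
\<close>

lemma near_Int_avoid:
  assumes "i \<in> I"
  shows "near I i {0<..<1} \<inter> avoid I = near I i {0<..<1/2} \<union> near I i {1/2<..<1}"
proof -
  have "\<delta> (x j) > 0 \<longleftrightarrow> h (x i) \<noteq> 1/2 \<or> j \<noteq> i" if x: "x \<in> near I i {0<..<1}" and j: "j \<in> I" for x j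
  proof -
    have xi: "x i \<in> topspace Z" "\<delta> (x i) < 1/2"
      using x assms by (auto simp: near_def topspace_sink_conf)
    have "\<delta> (x j) > \<delta> (x i)" if "j \<noteq> i" using x j that by (auto simp: near_def)
    then show ?thesis using \<delta>_eq_abs[OF xi] by (cases "j = i") auto
  qed
  then have "x \<in> avoid I \<longleftrightarrow> h (x i) \<noteq> 1/2" if "x \<in> near I i {0<..<1}" for x
    using that assms by (auto simp: avoid_def near_def)
  moreover have "x \<in> near I i {0<..<1/2} \<union> near I i {1/2<..<1} \<longleftrightarrow>
      x \<in> near I i {0<..<1} \<and> h (x i) \<noteq> 1/2" for x
    by (auto simp: near_def)
  ultimately show ?thesis by blast
qed

text \<open>
  The inductive step. The cover consists of \<open>avoid I\<close>, which looks like the configurations of \<open>I\<close>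
  outside the edge, and of the disjoint pieces \<open>near I i {0<..<1}\<close>, each of which looks like the
  configurations of \<open>I - {i}\<close> outside the edge. The intersection consists of two such pieces for each
  \<open>i\<close>, one per side of the midpoint; this is the source of the factor 2.
\<close>

context
  fixes I :: "'i set" and d :: int
  assumes fin: "finite I"
    and vanish: "\<And>p. p > d \<Longrightarrow> trivial_group (homology_group p (sink_conf I (subtopology Z Z\<^sub>0) V))"
    and vanish': "\<And>p i. p > d \<Longrightarrow> i \<in> I \<Longrightarrow>
        trivial_group (homology_group p (sink_conf (I - {i}) (subtopology Z Z\<^sub>0) V))"
begin

lemma
  shows homology_sink_conf_vanish: "p > d + 1 \<Longrightarrow> trivial_group (homology_group p (sink_conf I Z V))"
    and int_rank_homology_sink_conf_upper:
      "int_rank (homology_group (d + 1) (sink_conf I Z V)) \<le>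
         2 * (\<Sum>i\<in>I. int_rank (homology_group d (sink_conf (I - {i}) (subtopology Z Z\<^sub>0) V)))"
    and int_rank_homology_sink_conf_lower:
      "2 * (\<Sum>i\<in>I. int_rank (homology_group d (sink_conf (I - {i}) (subtopology Z Z\<^sub>0) V))) \<le>
         int_rank (homology_group (d + 1) (sink_conf I Z V))
         + int_rank (homology_group d (sink_conf I (subtopology Z Z\<^sub>0) V))
         + (\<Sum>i\<in>I. int_rank (homology_group d (sink_conf (I - {i}) (subtopology Z Z\<^sub>0) V)))"
proof -
  let ?Y = "sink_conf I Z V"
  let ?r = "\<lambda>i. int_rank (homology_group d (sink_conf (I - {i}) (subtopology Z Z\<^sub>0) V))"
  define L R :: "real set" where "L = {0<..<1/2}" and "R = {1/2<..<1}"
  define U where "U = (\<Union>i\<in>I. near I i {0<..<1})"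
  define side where "side = (\<lambda>(i, T). near I i T)"
  have UA: "U \<inter> avoid I = (\<Union>k\<in>I \<times> {L, R}. side k)"
  proof -
    have "U \<inter> avoid I = (\<Union>i\<in>I. near I i L \<union> near I i R)"
      using near_Int_avoid[of _ I] unfolding U_def L_def R_def by blast
    then show ?thesis by (auto simp: side_def)
  qed
  have opU: "openin ?Y U" unfolding U_def using fin by (intro openin_Union) (auto intro: openin_near)
  have opA: "openin ?Y (avoid I)" using fin by (rule openin_avoid)
  have cov: "avoid I \<union> U = topspace ?Y" unfolding U_def by (rule avoid_near_cover)
  have "L \<noteq> R"
  proof -
    have "1/4 \<in> L" "1/4 \<notin> R" by (auto simp: L_def R_def)
    then show ?thesis by metis
  qed
  have eqA: "subtopology ?Y (avoid I) homotopy_equivalent_space sink_conf I (subtopology Z Z\<^sub>0) V"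
    by (rule sink_conf_avoid_homotopy_equivalent)
  have eqU: "subtopology ?Y (near I i {0<..<1}) homotopy_equivalent_space sink_conf (I - {i}) (subtopology Z Z\<^sub>0) V"
    if "i \<in> I" for i
    using that by (intro sink_conf_near_homotopy_equivalent[of _ _ "1/2"]) auto
  have eqS: "subtopology ?Y (side (i, T)) homotopy_equivalent_space sink_conf (I - {i}) (subtopology Z Z\<^sub>0) V"
    if "i \<in> I" "T \<in> {L, R}" for i T
  proof -
    have "(if T = L then 1/4 else 3/4) \<in> T" "T \<subseteq> {0<..<1}" "convex T" "open T"
      using that \<open>L \<noteq> R\<close> by (auto simp: L_def R_def)
    then show ?thesis
      using that unfolding side_def by (auto intro: sink_conf_near_homotopy_equivalent)
  qed
  have openS: "openin ?Y (side k)" if "k \<in> I \<times> {L, R}" for k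
    using that fin by (auto simp: side_def L_def R_def intro!: openin_near)
  have disjS: "disjnt (side k) (side l)" if "k \<in> I \<times> {L, R}" "l \<in> I \<times> {L, R}" "k \<noteq> l" for k l
  proof (cases "fst k = fst l")
    case True
    then show ?thesis using that by (force simp: side_def disjnt_def near_def L_def R_def)
  next
    case False
    then show ?thesis using that disjnt_near[of "fst k" I "fst l"] by (auto simp: side_def)
  qed
  have openU: "openin ?Y (near I i {0<..<1})" if "i \<in> I" for i
    using that fin by (intro openin_near) auto
  have disjU: "disjnt (near I i {0<..<1}) (near I j {0<..<1})" if "i \<in> I" "j \<in> I" "i \<noteq> j" for i j
    using that by (rule disjnt_near)
  have finS: "finite (I \<times> {L, R})" using fin by simp
  have vA: "trivial_group (homology_group p (subtopology ?Y (avoid I)))" if "p > d" for p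
    using trivial_homology_homotopy_equivalent[OF eqA] vanish[OF that] by simp
  have vU: "trivial_group (homology_group p (subtopology ?Y U))" if "p > d" for p
    unfolding U_def using trivial_homology_homotopy_equivalent[OF eqU] vanish'[OF that]
    by (intro trivial_homology_disjoint_union[OF fin openU disjU]) auto
  have vS: "trivial_group (homology_group p (subtopology ?Y (U \<inter> avoid I)))" if "p > d" for p
    unfolding UA using trivial_homology_homotopy_equivalent[OF eqS] vanish'[OF that]
    by (intro trivial_homology_disjoint_union[OF finS openS disjS]) auto
  have rA: "int_rank (homology_group d (subtopology ?Y (avoid I)))
      = int_rank (homology_group d (sink_conf I (subtopology Z Z\<^sub>0) V))"
    by (rule int_rank_homology_homotopy_equivalent[OF eqA])
  have rU: "int_rank (homology_group d (subtopology ?Y U)) = (\<Sum>i\<in>I. ?r i)"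
    unfolding U_def using int_rank_homology_homotopy_equivalent[OF eqU, of _ d]
    by (subst int_rank_homology_disjoint_union[OF fin openU disjU]) auto
  have "int_rank (homology_group d (subtopology ?Y (U \<inter> avoid I)))
      = (\<Sum>k\<in>I \<times> {L, R}. int_rank (homology_group d (subtopology ?Y (side k))))"
    unfolding UA by (rule int_rank_homology_disjoint_union[OF finS openS disjS])
  also have "\<dots> = (\<Sum>k\<in>I \<times> {L, R}. ?r (fst k))"
    using int_rank_homology_homotopy_equivalent[OF eqS, of _ _ d] by (intro sum.cong) auto
  also have "\<dots> = (\<Sum>i\<in>I. \<Sum>T\<in>{L, R}. ?r i)"
    unfolding sum.cartesian_product by (rule sum.cong) auto
  also have "\<dots> = 2 * (\<Sum>i\<in>I. ?r i)"
    using \<open>L \<noteq> R\<close> by (simp add: sum.distrib mult_2)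
  finally have rS: "int_rank (homology_group d (subtopology ?Y (U \<inter> avoid I))) = 2 * (\<Sum>i\<in>I. ?r i)" .
  show "trivial_group (homology_group p ?Y)" if "p > d + 1"
    using homology_open_cover_vanish[OF opA opU cov vA vU vS that] .
  show "int_rank (homology_group (d + 1) ?Y) \<le> 2 * (\<Sum>i\<in>I. ?r i)"
    unfolding rS[symmetric] by (rule homology_open_cover_upper[OF opA opU cov vA vU vS])
  show "2 * (\<Sum>i\<in>I. ?r i) \<le> int_rank (homology_group (d + 1) ?Y)
      + int_rank (homology_group d (sink_conf I (subtopology Z Z\<^sub>0) V)) + (\<Sum>i\<in>I. ?r i)"
    using homology_open_cover_lower[where d = d, OF opA opU cov vA vU vS]
    unfolding rS rU rA .
qed

end

end

section \<open>Collapsing an edge onto its end points\<close>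

lemma continuous_map_closed_cover3:
  assumes "closedin X A" "closedin X B" "closedin X C" "topspace X \<subseteq> A \<union> B \<union> C"
    and "continuous_map (subtopology X A) Y f" "continuous_map (subtopology X B) Y f"
      "continuous_map (subtopology X C) Y f"
  shows "continuous_map X Y f"
  using assms by (intro pasting_lemma_closed[of "{A, B, C}" X id Y "\<lambda>_. f"]) auto

text \<open>
  The characteristic map of a loop is not injective, but its restrictions to the two halves of the
  interval are, and continuous injections of compact intervals are closed embeddings.
\<close>

lemma closed_arc_inverse:
  fixes \<phi> :: "real \<Rightarrow> 'a"
  assumes "Hausdorff_space X" and \<phi>: "continuous_map (top_of_set {0..1}) X \<phi>"
    and ab: "{a..b} \<subseteq> {0..1}" and inj: "inj_on \<phi> {a..b}"
  obtains g where "closedin X (\<phi> ` {a..b})"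
    "continuous_map (subtopology X (\<phi> ` {a..b})) euclideanreal g" "\<And>t. t \<in> {a..b} \<Longrightarrow> g (\<phi> t) = t"
proof -
  have cont: "continuous_map (top_of_set {a..b}) X \<phi>"
    using continuous_map_from_subtopology_mono[OF \<phi> ab] .
  have comp: "compact_space (top_of_set {a..b})"
    by (simp add: compact_space_subtopology)
  have "embedding_map (top_of_set {a..b}) X \<phi>"
    using cont comp assms(1) inj by (intro continuous_imp_embedding_map) auto
  then obtain g where g: "homeomorphic_maps (top_of_set {a..b}) (subtopology X (\<phi> ` {a..b})) \<phi> g"
    by (auto simp: embedding_map_def homeomorphic_map_maps)
  show thesis
  proof
    have "compactin X (\<phi> ` {a..b})"
      using image_compactin[OF _ cont, of "{a..b}"] by (simp add: compactin_subtopology)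
    then show "closedin X (\<phi> ` {a..b})"
      using assms(1) by (rule compactin_imp_closedin[rotated])
    show "continuous_map (subtopology X (\<phi> ` {a..b})) euclideanreal g"
      using g by (auto simp: homeomorphic_maps_def intro: continuous_map_into_fulltopology)
    show "g (\<phi> t) = t" if "t \<in> {a..b}" for t
      using g that by (auto simp: homeomorphic_maps_def)
  qed
qed

text \<open>
  In coordinates, the homotopy moves \<open>[0, 1/2)\<close> linearly to 0 and \<open>(1/2, 1]\<close> linearly to 1.
\<close>

definition squeeze :: "real \<Rightarrow> real \<Rightarrow> real" where
  "squeeze \<tau> t = (if t < 1/2 then (1 - \<tau>) * t else 1 - (1 - \<tau>) * (1 - t))"

lemma squeeze_bounds:
  assumes "\<tau> \<in> {0..1}" "t \<in> {0..1}"
  shows "squeeze \<tau> t \<in> {0..1}"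
  using assms mult_le_one[of "1 - \<tau>" t] mult_le_one[of "1 - \<tau>" "1 - t"] by (auto simp: squeeze_def)

lemma squeeze_dist:
  assumes "\<tau> \<in> {0..1}" "t \<in> {0..1}"
  shows "\<bar>squeeze \<tau> t - 1/2\<bar> = \<tau> / 2 + (1 - \<tau>) * \<bar>t - 1/2\<bar>"
proof (cases "t < 1/2")
  case True
  define u where "u = (1 - \<tau>) * t"
  have "u \<le> 1 * t" unfolding u_def using assms by (intro mult_right_mono) auto
  then have "\<bar>u - 1/2\<bar> = 1/2 - u" "\<bar>t - 1/2\<bar> = 1/2 - t"
    using True by linarith+
  then show ?thesis using True by (simp add: squeeze_def u_def field_simps)
next
  case False
  define u where "u = (1 - \<tau>) * (1 - t)"
  have "u \<le> 1 * (1 - t)" unfolding u_def using assms by (intro mult_right_mono) auto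
  then have "\<bar>1/2 - u\<bar> = 1/2 - u" "\<bar>t - 1/2\<bar> = t - 1/2"
    using False by simp_all
  moreover have "squeeze \<tau> t - 1/2 = 1/2 - u" using False by (simp add: squeeze_def u_def)
  ultimately show ?thesis by (simp add: u_def field_simps)
qed

lemma squeeze_inj:
  assumes \<tau>: "\<tau> \<in> {0..1}" and t: "0 < t" "t < 1" "t \<noteq> 1/2" and s: "0 < s" "s < 1" "s \<noteq> 1/2"
    and eq: "squeeze \<tau> t = squeeze \<tau> s" and in01: "0 < squeeze \<tau> t" "squeeze \<tau> t < 1"
  shows "t = s"
proof -
  have \<tau>1: "\<tau> \<noteq> 1" using in01 by (auto simp: squeeze_def split: if_splits)
  have less: "squeeze \<tau> u < 1/2" if "u < 1/2" "0 < u" for u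
  proof -
    have "(1 - \<tau>) * u \<le> 1 * u" using \<tau> that by (intro mult_right_mono) auto
    then show ?thesis using that unfolding squeeze_def by (simp; linarith)
  qed
  have greater: "squeeze \<tau> u > 1/2" if "u > 1/2" "u < 1" for u
  proof -
    have "(1 - \<tau>) * (1 - u) \<le> 1 - u" using mult_right_mono[of "1 - \<tau>" 1 "1 - u"] \<tau> that by simp
    moreover have "squeeze \<tau> u = 1 - (1 - \<tau>) * (1 - u)" using that by (simp add: squeeze_def)
    ultimately show ?thesis using that by linarith
  qed
  consider "t < 1/2" "s < 1/2" | "t > 1/2" "s > 1/2" | "t < 1/2" "s > 1/2" | "t > 1/2" "s < 1/2"
    using t s by linarith
  then show ?thesis
  proof cases
    case 1
    then show ?thesis using eq \<tau>1 by (simp add: squeeze_def)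
  next
    case 2
    then show ?thesis using eq \<tau>1 by (simp add: squeeze_def)
  next
    case 3
    then show ?thesis using eq less[of t] greater[of s] t s by simp
  next
    case 4
    then show ?thesis using eq less[of s] greater[of t] t s by simp
  qed
qed

text \<open>
  The functions \<open>\<delta>\<close> and \<open>K\<close> are defined through the coordinate \<open>h\<close> on the open edge, which gives no
  hint of their continuity at the end points. For this the space is covered by the three closed sets
  \<open>Z\<^sub>0\<close>, \<open>L\<close> and \<open>R\<close>, the latter being the closed halves of the edge, and on each half the coordinate
  extends continuously to the end point.
\<close>

lemma characteristic_map_edge_deformation:
  fixes X :: "'a topology" and \<phi> :: "real \<Rightarrow> 'a"
  assumes X: "Hausdorff_space X" and char: "characteristic_map_1 X V e \<phi>"
    and sub: "V \<subseteq> Z\<^sub>0" "Z\<^sub>0 \<union> e \<subseteq> topspace X" and disj: "Z\<^sub>0 \<inter> e = {}"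
    and closed: "closedin (subtopology X (Z\<^sub>0 \<union> e)) Z\<^sub>0"
  shows "\<exists>\<delta> h K. edge_deformation (subtopology X (Z\<^sub>0 \<union> e)) Z\<^sub>0 V \<delta> h \<phi> K"
proof -
  let ?Z = "subtopology X (Z\<^sub>0 \<union> e)"
  have \<phi>: "continuous_map (top_of_set {0..1}) X \<phi>"
    and hm: "homeomorphic_map (top_of_set {0<..<1}) (subtopology X e) \<phi>"
    and ends: "\<phi> 0 \<in> V" "\<phi> 1 \<in> V"
    using char by (auto simp: characteristic_map_1_def)
  have topZ: "topspace ?Z = Z\<^sub>0 \<union> e" using sub by auto
  obtain h where h: "homeomorphic_maps (top_of_set {0<..<1}) (subtopology X e) \<phi> h"
    using hm by (auto simp: homeomorphic_map_maps)
  have \<phi>e: "\<phi> t \<in> e" if "0 < t" "t < 1" for t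
    using h that by (auto simp: homeomorphic_maps_def continuous_map_def Pi_def)
  have h\<phi>: "h (\<phi> t) = t" if "0 < t" "t < 1" for t
    using h that by (auto simp: homeomorphic_maps_def)
  have \<phi>h: "\<phi> (h z) = z" "0 < h z" "h z < 1" if "z \<in> e" for z
    using h that sub by (auto simp: homeomorphic_maps_def continuous_map_def Pi_def)
  have end_not: "\<phi> 0 \<notin> e" "\<phi> 1 \<notin> e" using ends sub disj by auto
  have in_e: "\<phi> t \<in> e \<longleftrightarrow> t \<noteq> 0 \<and> t \<noteq> 1" if "t \<in> {0..1}" for t
    using that end_not \<phi>e[of t] by (metis atLeastAtMost_iff less_le)
  have inj: "s = t" if "s \<in> {0..1}" "t \<in> {0..1}" "\<phi> s = \<phi> t" "s \<noteq> 0" "s \<noteq> 1" for s t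
  proof -
    have "t \<noteq> 0" "t \<noteq> 1" using in_e that by metis+
    then have "h (\<phi> s) = s" "h (\<phi> t) = t" using that by (intro h\<phi>; simp)+
    then show ?thesis using that(3) by metis
  qed
  have inj1: "inj_on \<phi> {0..1/2}"
  proof (rule inj_onI)
    fix s t :: real assume st: "s \<in> {0..1/2}" "t \<in> {0..1/2}" "\<phi> s = \<phi> t"
    show "s = t"
      using inj[of s t] inj[of t s] st by (cases "s = 0"; cases "t = 0") simp_all
  qed
  have inj2: "inj_on \<phi> {1/2..1}"
  proof (rule inj_onI)
    fix s t :: real assume st: "s \<in> {1/2..1}" "t \<in> {1/2..1}" "\<phi> s = \<phi> t"
    show "s = t"
      using inj[of s t] inj[of t s] st by (cases "s = 1"; cases "t = 1") simp_all
  qed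
  define L R where "L = \<phi> ` {0..1/2}" and "R = \<phi> ` {1/2..1}"
  obtain l where L: "closedin X L" and l: "continuous_map (subtopology X L) euclideanreal l"
      "\<And>t. t \<in> {0..1/2} \<Longrightarrow> l (\<phi> t) = t"
    using closed_arc_inverse[OF X \<phi> _ inj1] unfolding L_def by auto
  obtain r where R: "closedin X R" and r: "continuous_map (subtopology X R) euclideanreal r"
      "\<And>t. t \<in> {1/2..1} \<Longrightarrow> r (\<phi> t) = t"
    using closed_arc_inverse[OF X \<phi> _ inj2] unfolding R_def by auto
  have \<phi>Z: "\<phi> t \<in> Z\<^sub>0 \<union> e" if "t \<in> {0..1}" for t
    using in_e[OF that] ends sub by blast
  have LRsub: "L \<subseteq> Z\<^sub>0 \<union> e" "R \<subseteq> Z\<^sub>0 \<union> e"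
    unfolding L_def R_def by (intro image_subsetI \<phi>Z; simp)+
  have LZ: "closedin ?Z L" and RZ: "closedin ?Z R"
    using L R LRsub by (auto simp: closedin_subtopology)
  have subLR: "subtopology ?Z L = subtopology X L" "subtopology ?Z R = subtopology X R"
    by (simp_all add: subtopology_subtopology Int_absorb1 LRsub)
  have cover: "Z\<^sub>0 \<union> e \<subseteq> Z\<^sub>0 \<union> L \<union> R"
  proof
    fix z assume "z \<in> Z\<^sub>0 \<union> e"
    moreover have "z \<in> L \<union> R" if "z \<in> e"
      using \<phi>h[OF that] unfolding L_def R_def
      by (cases "h z \<le> 1/2") (auto intro: image_eqI[of _ _ "h z"])
    ultimately show "z \<in> Z\<^sub>0 \<union> L \<union> R" by auto
  qed
  define \<delta> where "\<delta> z = (if z \<in> e then \<bar>h z - 1/2\<bar> else 1/2)" for z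
  define K where "K p = (if snd p \<in> e then \<phi> (squeeze (fst p) (h (snd p))) else snd p)" for p :: "real \<times> 'a"
  have \<delta>\<phi>: "\<delta> (\<phi> t) = \<bar>t - 1/2\<bar>" if "t \<in> {0..1}" for t
    using that in_e[OF that] h\<phi>[of t] by (cases "t = 0"; cases "t = 1") (simp_all add: \<delta>_def)
  have half: "\<bar>h z - 1/2\<bar> < 1/2" if "z \<in> e" for z
    using \<phi>h(2,3)[OF that] by linarith
  have \<delta>_small: "\<delta> z < 1/2 \<longleftrightarrow> z \<in> e" for z using half by (auto simp: \<delta>_def)
  have K\<phi>: "K (\<tau>, \<phi> t) = \<phi> (squeeze \<tau> t)" if "t \<in> {0..1}" for \<tau> t
    using that in_e[OF that] h\<phi>[of t]
    by (cases "t = 0"; cases "t = 1") (simp_all add: K_def squeeze_def)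
  have "edge_deformation ?Z Z\<^sub>0 V \<delta> h \<phi> K"
  proof
    show "V \<subseteq> Z\<^sub>0" by fact
    show "Z\<^sub>0 \<subseteq> topspace ?Z" using sub by auto
    show "continuous_map ?Z euclideanreal \<delta>"
    proof (rule continuous_map_closed_cover3[OF closed LZ RZ])
      show "topspace ?Z \<subseteq> Z\<^sub>0 \<union> L \<union> R" unfolding topZ by (rule cover)
      show "continuous_map (subtopology ?Z Z\<^sub>0) euclideanreal \<delta>"
        by (rule continuous_map_eq[of _ _ "\<lambda>_. 1/2"]) (use disj in \<open>auto simp: \<delta>_def\<close>)
      have "continuous_map (subtopology ?Z L) euclideanreal (\<lambda>z. \<bar>l z - 1/2\<bar>)"
        unfolding subLR using l(1) by (intro continuous_map_real_abs continuous_map_diff) simp_all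
      then show "continuous_map (subtopology ?Z L) euclideanreal \<delta>"
        by (rule continuous_map_eq) (auto simp: L_def \<delta>\<phi> l(2))
      have "continuous_map (subtopology ?Z R) euclideanreal (\<lambda>z. \<bar>r z - 1/2\<bar>)"
        unfolding subLR using r(1) by (intro continuous_map_real_abs continuous_map_diff) simp_all
      then show "continuous_map (subtopology ?Z R) euclideanreal \<delta>"
        by (rule continuous_map_eq) (auto simp: R_def \<delta>\<phi> r(2))
    qed
    show "0 \<le> \<delta> z \<and> \<delta> z \<le> 1/2" for z using half[of z] by (auto simp: \<delta>_def)
    show "\<delta> z = 1/2 \<longleftrightarrow> z \<in> Z\<^sub>0" if "z \<in> topspace ?Z" for z
      using that half[of z] disj by (auto simp: \<delta>_def topZ)
    have "subtopology ?Z {z. \<delta> z < 1/2} = subtopology X e"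
      unfolding \<delta>_small by (simp add: subtopology_subtopology Int_absorb1)
    then show "continuous_map (subtopology ?Z {z. \<delta> z < 1/2}) euclideanreal h"
      using h by (auto simp: homeomorphic_maps_def intro: continuous_map_into_fulltopology)
    have "continuous_map (top_of_set {0<..<1}) X \<phi>"
      by (rule continuous_map_from_subtopology_mono[OF \<phi>]) auto
    then show "continuous_map (top_of_set {0<..<1}) ?Z \<phi>"
      using \<phi>e by (auto simp: continuous_map_in_subtopology)
    show "\<delta> (\<phi> t) = \<bar>t - 1/2\<bar> \<and> h (\<phi> t) = t" if "0 < t" "t < 1" for t
      using that \<delta>\<phi> h\<phi> by simp
    show "0 < h z \<and> h z < 1 \<and> \<phi> (h z) = z" if "\<delta> z < 1/2" for z
      using that \<phi>h unfolding \<delta>_small by blast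
    show "K (0, z) = z" for z
      using \<phi>h[of z] by (auto simp: K_def squeeze_def)
    show "K (\<tau>, z) = z" if "z \<in> Z\<^sub>0" for \<tau> z using that disj by (auto simp: K_def)
    show "\<delta> (K (\<tau>, z)) = \<tau> / 2 + (1 - \<tau>) * \<delta> z" if "\<tau> \<in> {0..1}" for \<tau> z
    proof (cases "z \<in> e")
      case True
      then have hz: "h z \<in> {0..1}" using \<phi>h(2,3)[OF True] by simp
      have "\<delta> (K (\<tau>, z)) = \<bar>squeeze \<tau> (h z) - 1/2\<bar>"
        using True \<delta>\<phi>[OF squeeze_bounds[OF that hz]] by (simp add: K_def)
      also have "\<dots> = \<tau> / 2 + (1 - \<tau>) * \<delta> z"
        using True squeeze_dist[OF that hz] by (simp add: \<delta>_def)
      finally show ?thesis .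
    next
      case False
      then show ?thesis by (simp add: K_def \<delta>_def field_simps)
    qed
    have e_of_K: "0 < squeeze \<tau> (h z)" "squeeze \<tau> (h z) < 1"
      if "z \<in> e" "\<tau> \<in> {0..1}" "\<phi> (squeeze \<tau> (h z)) \<notin> V" for \<tau> z
    proof -
      have "squeeze \<tau> (h z) \<in> {0..1}"
        using \<phi>h(2,3)[OF that(1)] by (intro squeeze_bounds that) auto
      then show "0 < squeeze \<tau> (h z)" "squeeze \<tau> (h z) < 1"
        using that ends by (auto simp: less_le)
    qed
    show "K (\<tau>, z) \<in> V" if "z \<in> topspace ?Z" "\<tau> \<in> {0..1}" "z \<notin> Z\<^sub>0" "K (\<tau>, z) \<in> Z\<^sub>0" for \<tau> z
    proof (rule ccontr)
      have z: "z \<in> e" using that by (auto simp: topZ)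
      assume "K (\<tau>, z) \<notin> V"
      then have "K (\<tau>, z) \<in> e"
        using e_of_K[OF z that(2)] \<phi>e z by (simp add: K_def)
      then show False using that disj by auto
    qed
    show "z = w" if "z \<in> topspace ?Z" "\<delta> z > 0" "w \<in> topspace ?Z" "\<delta> w > 0" "\<tau> \<in> {0..1}"
      "K (\<tau>, z) \<notin> Z\<^sub>0" "K (\<tau>, z) = K (\<tau>, w)" for \<tau> z w
    proof -
      have e: "z \<in> e" "w \<in> e" using that disj by (auto simp: K_def topZ split: if_splits)
      have z01: "0 < squeeze \<tau> (h z)" "squeeze \<tau> (h z) < 1"
        using that e sub by (intro e_of_K; auto simp: K_def)+
      have w01: "0 < squeeze \<tau> (h w)" "squeeze \<tau> (h w) < 1"
        using that e sub by (intro e_of_K; auto simp: K_def)+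
      have eq: "squeeze \<tau> (h z) = squeeze \<tau> (h w)"
      proof -
        have "\<phi> (squeeze \<tau> (h z)) = \<phi> (squeeze \<tau> (h w))"
          using that(7) e by (simp only: K_def fst_conv snd_conv if_True)
        then show ?thesis using h\<phi>[OF z01] h\<phi>[OF w01] by metis
      qed
      have "h z \<noteq> 1/2" "h w \<noteq> 1/2" using that(2,4) e by (auto simp: \<delta>_def)
      then have "h z = h w"
        using squeeze_inj[OF that(5) \<phi>h(2,3)[OF e(1)] _ \<phi>h(2,3)[OF e(2)] _ eq z01] by blast
      then show ?thesis using \<phi>h(1) e by metis
    qed
    let ?D = "prod_topology (top_of_set {0..1::real}) (subtopology ?Z {z. \<delta> z > 0})"
    have topD: "topspace ?D = {0..1} \<times> {z \<in> Z\<^sub>0 \<union> e. \<delta> z > 0}" using topZ by auto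
    let ?part = "\<lambda>C. {p \<in> topspace ?D. snd p \<in> C}"
    have snd: "continuous_map ?D ?Z snd"
      using continuous_map_snd by (rule continuous_map_into_fulltopology)
    have part_closed: "closedin ?D (?part C)" if "closedin ?Z C" for C
      using closedin_continuous_map_preimage[OF snd that] .
    have fst_part: "continuous_map (subtopology ?D S) euclideanreal fst" for S
      using continuous_map_into_fulltopology[OF continuous_map_fst] by (rule continuous_map_from_subtopology)
    have snd_part: "continuous_map (subtopology ?D (?part C)) (subtopology X C) snd" for C
      using continuous_map_from_subtopology[OF continuous_map_into_fulltopology[OF snd]]
      by (auto simp: continuous_map_in_subtopology)
    have \<phi>_comp: "continuous_map (subtopology ?D S) X (\<lambda>p. \<phi> (f p))"
      if "continuous_map (subtopology ?D S) euclideanreal f"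
        "\<And>p. p \<in> topspace ?D \<Longrightarrow> p \<in> S \<Longrightarrow> f p \<in> {0..1}" for f S
    proof -
      have "continuous_map (subtopology ?D S) (top_of_set {0..1}) f"
        using that by (auto simp: continuous_map_in_subtopology)
      from continuous_map_compose[OF this \<phi>] show ?thesis by (simp add: o_def)
    qed
    have "continuous_map ?D X K"
    proof (rule continuous_map_closed_cover3[OF part_closed part_closed part_closed, OF closed LZ RZ])
      show "topspace ?D \<subseteq> ?part Z\<^sub>0 \<union> ?part L \<union> ?part R" using cover by (auto simp: topD)
      have "continuous_map (subtopology ?D (?part Z\<^sub>0)) X snd"
        using snd_part by (rule continuous_map_into_fulltopology)
      then show "continuous_map (subtopology ?D (?part Z\<^sub>0)) X K"
        by (rule continuous_map_eq) (use disj in \<open>auto simp: K_def\<close>)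
      have arc: "\<exists>t. t \<in> {0..1/2} \<and> snd p = \<phi> t \<and> t < 1/2"
        if "p \<in> topspace ?D" "snd p \<in> L" for p
      proof -
        from that obtain t where "t \<in> {0..1/2}" "snd p = \<phi> t" by (auto simp: L_def)
        moreover from this have "t \<noteq> 1/2" using that \<delta>\<phi>[of t] by (auto simp: topD)
        ultimately show ?thesis by auto
      qed
      have "continuous_map (subtopology ?D (?part L)) euclideanreal (\<lambda>p. (1 - fst p) * l (snd p))"
        using continuous_map_compose[OF snd_part l(1)]
        by (intro continuous_map_real_mult continuous_map_diff fst_part) (auto simp: o_def)
      then have "continuous_map (subtopology ?D (?part L)) X (\<lambda>p. \<phi> ((1 - fst p) * l (snd p)))"
      proof (rule \<phi>_comp)
        fix p assume p: "p \<in> topspace ?D" "p \<in> ?part L"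
        then obtain t where "t \<in> {0..1/2}" "snd p = \<phi> t" "t < 1/2" using arc[of p] by auto
        then show "(1 - fst p) * l (snd p) \<in> {0..1}"
          using p(1) squeeze_bounds[of "fst p" t] by (auto simp: l(2) squeeze_def topD)
      qed
      then show "continuous_map (subtopology ?D (?part L)) X K"
      proof (rule continuous_map_eq)
        fix p assume p: "p \<in> topspace (subtopology ?D (?part L))"
        then obtain t where "t \<in> {0..1/2}" "snd p = \<phi> t" "t < 1/2" using arc[of p] by auto
        then show "\<phi> ((1 - fst p) * l (snd p)) = K p"
          using K\<phi>[of t "fst p"] by (cases p) (auto simp: l(2) squeeze_def)
      qed
      have arc': "\<exists>t. t \<in> {1/2..1} \<and> snd p = \<phi> t"
        if "p \<in> topspace ?D" "snd p \<in> R" for p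
        using that by (auto simp: R_def)
      have "continuous_map (subtopology ?D (?part R)) euclideanreal (\<lambda>p. 1 - (1 - fst p) * (1 - r (snd p)))"
        using continuous_map_compose[OF snd_part r(1)]
        by (intro continuous_map_real_mult continuous_map_diff fst_part) (auto simp: o_def)
      then have "continuous_map (subtopology ?D (?part R)) X (\<lambda>p. \<phi> (1 - (1 - fst p) * (1 - r (snd p))))"
      proof (rule \<phi>_comp)
        fix p assume p: "p \<in> topspace ?D" "p \<in> ?part R"
        then obtain t where "t \<in> {1/2..1}" "snd p = \<phi> t" using arc'[of p] by auto
        then show "1 - (1 - fst p) * (1 - r (snd p)) \<in> {0..1}"
          using p(1) squeeze_bounds[of "fst p" t] by (auto simp: r(2) squeeze_def topD)
      qed
      then show "continuous_map (subtopology ?D (?part R)) X K"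
      proof (rule continuous_map_eq)
        fix p assume p: "p \<in> topspace (subtopology ?D (?part R))"
        then obtain t where "t \<in> {1/2..1}" "snd p = \<phi> t" using arc'[of p] by auto
        then show "\<phi> (1 - (1 - fst p) * (1 - r (snd p))) = K p"
          using K\<phi>[of t "fst p"] by (cases p) (auto simp: r(2) squeeze_def)
      qed
    qed
    moreover have "K p \<in> Z\<^sub>0 \<union> e" if "p \<in> topspace ?D" for p
    proof (cases "snd p \<in> e")
      case True
      then have "squeeze (fst p) (h (snd p)) \<in> {0..1}"
        using that \<phi>h(2,3)[OF True] by (intro squeeze_bounds) (auto simp: topD)
      then show ?thesis using True \<phi>Z by (simp add: K_def)
    qed (use that in \<open>auto simp: K_def topD\<close>)
    ultimately show "continuous_map ?D ?Z K" by (auto simp: continuous_map_in_subtopology)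
  qed
  then show ?thesis by blast
qed

section \<open>Finiteness of compact graphs\<close>

lemma finite_closed_discrete_subset:
  assumes "compact_space X" "M \<subseteq> topspace X" "\<And>S. S \<subseteq> M \<Longrightarrow> closedin X S"
  shows "finite M"
proof -
  have "openin (subtopology X M) {x}" if "x \<in> M" for x
  proof -
    have "closedin (subtopology X M) (M - {x})"
      using assms(3)[of "M - {x}"] by (auto simp: closedin_subtopology)
    then have "openin (subtopology X M) (topspace (subtopology X M) - (M - {x}))" by blast
    moreover have "topspace (subtopology X M) - (M - {x}) = {x}" using that assms(2) by auto
    ultimately show ?thesis by simp
  qed
  then have "subtopology X M = discrete_topology M"
    using assms(2) by (subst eq_commute) (auto simp: discrete_topology_unique)
  moreover have "compact_space (subtopology X M)"
    using assms by (intro compact_space_subtopology closedin_compact_space) auto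
  ultimately show ?thesis by (simp add: compact_space_discrete_topology)
qed

lemma characteristic_map_closure_subset:
  assumes X: "Hausdorff_space X" and e: "e \<subseteq> topspace X" and char: "characteristic_map_1 X V e \<phi>"
  shows "X closure_of e \<subseteq> e \<union> {\<phi> 0, \<phi> 1}"
proof -
  have \<phi>: "continuous_map (top_of_set {0..1}) X \<phi>"
    and hm: "homeomorphic_map (top_of_set {0<..<1}) (subtopology X e) \<phi>"
    using char by (auto simp: characteristic_map_1_def)
  have im: "\<phi> ` {0<..<1} = e"
    using homeomorphic_imp_surjective_map[OF hm] e by auto
  have "compactin X (\<phi> ` {0..1})"
    using image_compactin[OF _ \<phi>, of "{0..1}"] by (simp add: compactin_subtopology)
  then have "closedin X (\<phi> ` {0..1})" using X by (rule compactin_imp_closedin[rotated])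
  moreover have "\<phi> ` {0..1} = e \<union> {\<phi> 0, \<phi> 1}"
  proof -
    have "{0..1} = {0<..<1} \<union> {0, 1::real}" by auto
    then show ?thesis using im by (simp add: image_Un)
  qed
  ultimately show ?thesis by (intro closure_of_minimal) auto
qed

text \<open>
  In the weak topology a set is closed as soon as it meets each closed edge in a finite set. This
  applies to every set of vertices and to every set of edge midpoints, so both \<open>V\<close> and the set of
  midpoints are closed and discrete, hence finite by compactness.
\<close>

lemma
  assumes "CW_graph X V E"
  shows CW_graph_finite_vertices: "finite V"
    and CW_graph_finite_edges: "finite E"
    and CW_graph_vertices_nonempty: "V \<noteq> {}"
    and CW_graph_edge_open: "e \<in> E \<Longrightarrow> openin X e"
proof -
  have X: "Hausdorff_space X" "compact_space X"
    and top: "V \<union> \<Union>E = topspace X" "V \<inter> \<Union>E = {}" "pairwise disjnt E" "E \<noteq> {}"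
    and char: "\<And>e. e \<in> E \<Longrightarrow> \<exists>\<phi>. characteristic_map_1 X V e \<phi>"
    and weak: "\<And>A. A \<subseteq> topspace X \<Longrightarrow>
        (\<And>v. v \<in> V \<Longrightarrow> closedin X (A \<inter> {v})) \<Longrightarrow> (\<And>e. e \<in> E \<Longrightarrow> closedin X (A \<inter> X closure_of e)) \<Longrightarrow>
        closedin X A"
    using assms by (auto simp: CW_graph_def CW_complex_1_def)
  have fin_closed: "closedin X S" if "finite S" "S \<subseteq> topspace X" for S
    using X(1) that Hausdorff_imp_t1_space t1_space_closedin_finite by blast
  have sub: "e \<subseteq> topspace X" "V \<inter> e = {}" if "e \<in> E" for e using that top by auto
  obtain \<phi> where \<phi>: "\<And>e. e \<in> E \<Longrightarrow> characteristic_map_1 X V e (\<phi> e)" using char by metis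
  have ends: "\<phi> e 0 \<in> V" "\<phi> e 1 \<in> V" if "e \<in> E" for e
    using \<phi>[OF that] by (auto simp: characteristic_map_1_def)
  have cl: "X closure_of e \<subseteq> e \<union> {\<phi> e 0, \<phi> e 1}" if "e \<in> E" for e
    using that by (intro characteristic_map_closure_subset[OF X(1) sub(1) \<phi>])
  have disj: "e \<inter> e' = {}" if "e \<in> E" "e' \<in> E" "e \<noteq> e'" for e e'
    using top(3) that by (auto simp: pairwise_def disjnt_def)
  show "finite V"
  proof (rule finite_closed_discrete_subset[OF X(2)])
    show "V \<subseteq> topspace X" using top by auto
    fix S assume S: "S \<subseteq> V"
    show "closedin X S"
    proof (rule weak)
      show "S \<subseteq> topspace X" using S top by auto
      show "closedin X (S \<inter> {v})" if "v \<in> V" for v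
        using that top by (intro fin_closed) auto
      show "closedin X (S \<inter> X closure_of e)" if e: "e \<in> E" for e
      proof (rule fin_closed)
        have "S \<inter> X closure_of e \<subseteq> {\<phi> e 0, \<phi> e 1}" using S cl[OF e] sub(2)[OF e] by auto
        then show "finite (S \<inter> X closure_of e)" by (rule finite_subset) simp
      qed (use S top in auto)
    qed
  qed
  define m where "m e = \<phi> e (1/2)" for e
  have m: "m e \<in> e" if "e \<in> E" for e
    using \<phi>[OF that] unfolding characteristic_map_1_def m_def
    by (auto dest!: homeomorphic_imp_continuous_map simp: continuous_map_def Pi_def)
  have "finite (m ` E)"
  proof (rule finite_closed_discrete_subset[OF X(2)])
    show "m ` E \<subseteq> topspace X" using m sub by blast
    fix S assume S: "S \<subseteq> m ` E"
    show "closedin X S"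
    proof (rule weak)
      show top_S: "S \<subseteq> topspace X" using S m sub by blast
      show "closedin X (S \<inter> {v})" if "v \<in> V" for v
        using top_S by (intro fin_closed) auto
      show "closedin X (S \<inter> X closure_of e)" if e: "e \<in> E" for e
      proof (rule fin_closed)
        have "S \<inter> X closure_of e \<subseteq> {m e, \<phi> e 0, \<phi> e 1}"
        proof
          fix x assume x: "x \<in> S \<inter> X closure_of e"
          then obtain e' where e': "e' \<in> E" "x = m e'" using S by auto
          show "x \<in> {m e, \<phi> e 0, \<phi> e 1}"
            using x e' cl[OF e] m[OF e'(1)] disj[OF e e'(1)] by (cases "e = e'") auto
        qed
        then show "finite (S \<inter> X closure_of e)" by (rule finite_subset) simp
      qed (use top_S in auto)
    qed
  qed
  moreover have "inj_on m E"
  proof (rule inj_onI)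
    fix e e' assume "e \<in> E" "e' \<in> E" "m e = m e'"
    then show "e = e'" using m disj by (metis disjoint_iff)
  qed
  ultimately show "finite E" by (rule finite_imageD)
  show "V \<noteq> {}" using top(4) ends by auto
  show "openin X e" if e: "e \<in> E"
  proof -
    have "closedin X (topspace X - e)"
    proof (rule weak)
      show "closedin X ((topspace X - e) \<inter> {v})" for v by (intro fin_closed) auto
      show "closedin X ((topspace X - e) \<inter> X closure_of e')" if e': "e' \<in> E" for e'
      proof (cases "e' = e")
        case True
        have "(topspace X - e) \<inter> X closure_of e' \<subseteq> {\<phi> e 0, \<phi> e 1}" using cl[OF e] True by auto
        then have "finite ((topspace X - e) \<inter> X closure_of e')" by (rule finite_subset) simp
        then show ?thesis by (rule fin_closed) auto
      next
        case False
        have "X closure_of e' \<subseteq> topspace X - e"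
          using cl[OF e'] disj[OF e e'] False ends[OF e'] sub(2)[OF e] sub(1)[OF e'] top(1) by blast
        then show ?thesis by (simp add: Int_absorb1)
      qed
    qed auto
    moreover have "topspace X - (topspace X - e) = e" using sub(1)[OF e] by auto
    ultimately show ?thesis by (metis openin_diff openin_topspace)
  qed
qed

text \<open>
  Open edges are open in the graph, so removing one leaves a closed part of every subgraph.
\<close>

lemma subgraph_edge_deformation:
  assumes graph: "CW_graph X V E" and F: "F \<subseteq> E" and e: "e \<in> E" "e \<notin> F"
  shows "\<exists>\<delta> h \<phi> K. edge_deformation (subtopology X (V \<union> \<Union>(insert e F))) (V \<union> \<Union>F) V \<delta> h \<phi> K"
proof -
  have X: "Hausdorff_space X"
    and top: "V \<union> \<Union>E = topspace X" "V \<inter> \<Union>E = {}" "pairwise disjnt E"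
    and char: "\<exists>\<phi>. characteristic_map_1 X V e \<phi>"
    using graph e by (auto simp: CW_graph_def CW_complex_1_def)
  obtain \<phi> where \<phi>: "characteristic_map_1 X V e \<phi>" using char by blast
  have disj: "(V \<union> \<Union>F) \<inter> e = {}"
    using top(2,3) e F by (fastforce simp: pairwise_def disjnt_def)
  have op: "openin X e" using CW_graph_edge_open[OF graph e(1)] .
  have sub: "V \<union> \<Union>F \<union> e \<subseteq> topspace X" using top(1) F e by auto
  have "closedin X (topspace X - e)" using op by blast
  moreover have "V \<union> \<Union>F = (topspace X - e) \<inter> (V \<union> \<Union>F \<union> e)" using disj sub by auto
  ultimately have "closedin (subtopology X (V \<union> \<Union>F \<union> e)) (V \<union> \<Union>F)"
    unfolding closedin_subtopology by blast
  from characteristic_map_edge_deformation[OF X \<phi> _ sub disj this]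
  have "\<exists>\<delta> h K. edge_deformation (subtopology X (V \<union> \<Union>F \<union> e)) (V \<union> \<Union>F) V \<delta> h \<phi> K" by auto
  moreover have "V \<union> \<Union>(insert e F) = V \<union> \<Union>F \<union> e" by auto
  ultimately show ?thesis by metis
qed

text \<open>
  The base of the induction: on the vertices alone all collisions are allowed, and the configuration
  space is the finite discrete set of all maps from \<open>I\<close> to \<open>V\<close>.
\<close>

lemma
  assumes "Hausdorff_space X" "finite V" "V \<subseteq> topspace X" "finite I"
  shows int_rank_homology_sink_conf_vertices:
      "int_rank (homology_group 0 (sink_conf I (subtopology X V) V)) = enat (card V ^ card I)"
    and trivial_homology_sink_conf_vertices:
      "p \<noteq> 0 \<Longrightarrow> trivial_group (homology_group p (sink_conf I (subtopology X V) V))"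
proof -
  let ?Y = "sink_conf I (subtopology X V) V"
  have top: "topspace ?Y = (\<Pi>\<^sub>E i\<in>I. V)"
  proof -
    have "topspace (subtopology X V) = V" using assms(3) by auto
    then show ?thesis unfolding topspace_sink_conf by auto
  qed
  have fin: "finite (topspace ?Y)" unfolding top using assms by (intro finite_PiE) auto
  have "Hausdorff_space ?Y"
    unfolding sink_conf_def using assms(1)
    by (intro Hausdorff_space_subtopology) (simp add: Hausdorff_space_product_topology Hausdorff_space_subtopology)
  then have cl: "closedin ?Y S" if "S \<subseteq> topspace ?Y" for S
    using that fin finite_subset Hausdorff_imp_t1_space t1_space_closedin_finite by metis
  have op: "openin ?Y S" if S: "S \<subseteq> topspace ?Y" for S
  proof -
    have "topspace ?Y - (topspace ?Y - S) = S" using S by auto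
    then show ?thesis using cl[of "topspace ?Y - S"] by (metis Diff_subset openin_diff openin_topspace)
  qed
  have "card (topspace ?Y) = card V ^ card I"
    unfolding top using assms by (simp add: card_PiE)
  then show "int_rank (homology_group 0 ?Y) = enat (card V ^ card I)"
    using int_rank_homology_finite_discrete[OF fin op] by simp
  show "trivial_group (homology_group p ?Y)" if "p \<noteq> 0"
    using trivial_homology_finite_discrete[OF fin op that] .
qed

section \<open>Exponential polynomials\<close>

lemma power_quotient_tendsto_0:
  assumes "i < k"
  shows "(\<lambda>n. real n ^ i / real n ^ k) \<longlonglongrightarrow> 0"
proof -
  have "(\<lambda>n. inverse (real n) ^ (k - i)) \<longlonglongrightarrow> 0 ^ (k - i)"
    by (intro tendsto_power lim_inverse_n)
  then have "(\<lambda>n. inverse (real n) ^ (k - i)) \<longlonglongrightarrow> 0"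
    using assms by (simp only: zero_power zero_less_diff)
  moreover have "\<forall>\<^sub>F n in sequentially. inverse (real n) ^ (k - i) = real n ^ i / real n ^ k"
    using eventually_gt_at_top[of 0]
  proof eventually_elim
    case (elim n)
    have "real n ^ k = real n ^ i * real n ^ (k - i)" using assms by (simp flip: power_add)
    then show ?case using elim by (simp add: field_simps)
  qed
  ultimately show ?thesis by (rule Lim_transform_eventually)
qed

text \<open>
  With \<open>powser_times_n_limit_0\<close> for the case \<open>i = 1\<close>, writing \<open>x\<close> as an \<open>i\<close>-th power reduces the general case to it.
\<close>

lemma power_times_geometric_tendsto_0:
  fixes x :: real
  assumes "0 \<le> x" "x < 1"
  shows "(\<lambda>n. real n ^ i * x ^ n) \<longlonglongrightarrow> 0"
proof (cases "i = 0")
  case True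
  then show ?thesis using assms by (simp add: LIMSEQ_realpow_zero)
next
  case False
  define y where "y = root i x"
  have y: "0 \<le> y" "y < 1" "y ^ i = x"
    using assms False by (auto simp: y_def)
  have "(\<lambda>n. (real n * y ^ n) ^ i) \<longlonglongrightarrow> 0 ^ i"
    using y by (intro tendsto_power powser_times_n_limit_0) auto
  moreover have "(real n * y ^ n) ^ i = real n ^ i * x ^ n" for n
    unfolding y(3)[symmetric] by (simp add: power_mult_distrib mult.commute flip: power_mult)
  moreover have "(0::real) ^ i = 0" using False by simp
  ultimately show ?thesis by (simp only:)
qed

lemma real_of_rat_poly:
  "real_of_rat (poly p (of_nat n)) = (\<Sum>i\<le>degree p. real_of_rat (coeff p i) * real n ^ i)"
  by (simp add: poly_altdef of_rat_sum of_rat_mult of_rat_power)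

lemma poly_quotient_tendsto_lead_coeff:
  fixes p :: "rat poly"
  shows "(\<lambda>n. real_of_rat (poly p (of_nat n)) / real n ^ degree p) \<longlonglongrightarrow> real_of_rat (lead_coeff p)"
proof -
  have "(\<lambda>n. \<Sum>i\<le>degree p. real_of_rat (coeff p i) * (real n ^ i / real n ^ degree p))
      \<longlonglongrightarrow> (\<Sum>i\<le>degree p. real_of_rat (coeff p i) * (if i = degree p then 1 else 0))"
  proof (intro tendsto_sum tendsto_mult tendsto_const)
    fix i assume "i \<in> {..degree p}"
    show "(\<lambda>n. real n ^ i / real n ^ degree p) \<longlonglongrightarrow> (if i = degree p then 1 else 0)"
    proof (cases "i = degree p")
      case True
      have "\<forall>\<^sub>F n in sequentially. 1 = real n ^ i / real n ^ degree p"
        using eventually_gt_at_top[of 0] by eventually_elim (simp add: True)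
      then show ?thesis using True by (auto intro: Lim_transform_eventually[OF tendsto_const])
    next
      case False
      then show ?thesis using \<open>i \<in> _\<close> power_quotient_tendsto_0[of i "degree p"] by auto
    qed
  qed
  then show ?thesis
    by (simp add: real_of_rat_poly sum_divide_distrib if_distrib[of "\<lambda>x. _ * x"] cong: if_cong)
qed

text \<open>
  After division by \<open>n ^ d * v ^ n\<close> the terms with \<open>j < v\<close> tend to 0, so \<open>poly (p v) n / n ^ d\<close> stays
  bounded and bounded away from 0, which determines the degree.
\<close>

lemma degree_dominant_polynomial:
  fixes p :: "nat \<Rightarrow> rat poly" and C c :: real
  assumes v: "1 \<le> v" and c: "0 < c"
    and lower: "\<forall>\<^sub>F n in sequentially. c * real n ^ d * real v ^ n
        \<le> real_of_rat (\<Sum>j = 1..v. poly (p j) (of_nat n) * of_nat j ^ n)"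
    and upper: "\<forall>\<^sub>F n in sequentially.
        real_of_rat (\<Sum>j = 1..v. poly (p j) (of_nat n) * of_nat j ^ n) \<le> C * real n ^ d * real v ^ n"
  shows "degree (p v) = d"
proof -
  define f where "f j n = real_of_rat (poly (p j) (of_nat n))" for j n
  define e where "e n = (\<Sum>j\<in>{1..<v}. f j n * (real j / real v) ^ n) / real n ^ d" for n
  define D where "D = degree (p v)"
  define g where "g n = f v n / real n ^ D" for n
  have e: "e \<longlonglongrightarrow> 0"
  proof -
    have "(\<lambda>n. f j n * (real j / real v) ^ n) \<longlonglongrightarrow> 0" if "j \<in> {1..<v}" for j
    proof -
      have x: "0 \<le> real j / real v" "real j / real v < 1" using that v by auto
      have "(\<lambda>n. \<Sum>i\<le>degree (p j). real_of_rat (coeff (p j) i) * (real n ^ i * (real j / real v) ^ n))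
          \<longlonglongrightarrow> (\<Sum>i\<le>degree (p j). real_of_rat (coeff (p j) i) * 0)"
        by (intro tendsto_sum tendsto_mult tendsto_const power_times_geometric_tendsto_0 x)
      then show ?thesis by (simp add: f_def real_of_rat_poly sum_distrib_right mult.assoc)
    qed
    then have 1: "(\<lambda>n. \<Sum>j\<in>{1..<v}. f j n * (real j / real v) ^ n) \<longlonglongrightarrow> 0"
      by (intro tendsto_null_sum)
    show ?thesis
    proof (rule Lim_null_comparison[OF _ tendsto_rabs_zero[OF 1]])
      show "\<forall>\<^sub>F n in sequentially. norm (e n) \<le> \<bar>\<Sum>j\<in>{1..<v}. f j n * (real j / real v) ^ n\<bar>"
        using eventually_ge_at_top[of 1]
      proof eventually_elim
        case (elim n)
        have "1 \<le> real n ^ d" using elim by (intro one_le_power) simp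
        then show ?case
          by (simp add: e_def abs_divide divide_le_eq mult_le_cancel_left1)
      qed
    qed
  qed
  have eq: "real_of_rat (\<Sum>j = 1..v. poly (p j) (of_nat n) * of_nat j ^ n)
      = (f v n / real n ^ d + e n) * (real n ^ d * real v ^ n)" if "n \<ge> 1" for n
  proof -
    have "{1..v} = insert v {1..<v}" using v by auto
    then have "real_of_rat (\<Sum>j = 1..v. poly (p j) (of_nat n) * of_nat j ^ n)
        = f v n * real v ^ n + (\<Sum>j\<in>{1..<v}. f j n * real j ^ n)"
      by (simp add: f_def of_rat_sum of_rat_mult of_rat_power of_rat_add)
    also have "(\<Sum>j\<in>{1..<v}. f j n * real j ^ n) = e n * (real n ^ d * real v ^ n)"
    proof -
      have "e n * (real n ^ d * real v ^ n) = (\<Sum>j\<in>{1..<v}. f j n * (real j / real v) ^ n) * real v ^ n"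
        using that by (simp add: e_def)
      also have "\<dots> = (\<Sum>j\<in>{1..<v}. f j n * real j ^ n)"
        unfolding sum_distrib_right using v by (intro sum.cong) (simp_all add: power_divide)
      finally show ?thesis ..
    qed
    finally show ?thesis using that by (simp add: distrib_right)
  qed
  have bounds: "\<forall>\<^sub>F n in sequentially. c \<le> f v n / real n ^ d + e n \<and> f v n / real n ^ d + e n \<le> C"
    using lower upper eventually_ge_at_top[of 1]
  proof eventually_elim
    case (elim n)
    have "0 < real n ^ d * real v ^ n" using elim v by simp
    then show ?case
      using elim(1,2) unfolding eq[OF elim(3)] mult.assoc by (simp only: mult_le_cancel_right_pos)
  qed
  have g: "g \<longlonglongrightarrow> real_of_rat (lead_coeff (p v))"
    unfolding g_def f_def D_def by (rule poly_quotient_tendsto_lead_coeff)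
  show ?thesis
  proof (rule ccontr)
    assume "degree (p v) \<noteq> d"
    then consider "D < d" | "d < D" unfolding D_def by linarith
    then show False
    proof cases
      case 1
      have "(\<lambda>n. g n * (real n ^ D / real n ^ d) + e n) \<longlonglongrightarrow> real_of_rat (lead_coeff (p v)) * 0 + 0"
        using 1 by (intro tendsto_add tendsto_mult g e power_quotient_tendsto_0)
      moreover have "\<forall>\<^sub>F n in sequentially. g n * (real n ^ D / real n ^ d) + e n = f v n / real n ^ d + e n"
        using eventually_gt_at_top[of 0] by eventually_elim (simp add: g_def)
      ultimately have lim: "(\<lambda>n. f v n / real n ^ d + e n) \<longlonglongrightarrow> 0"
        using Lim_transform_eventually by fastforce
      have "c \<le> 0"
        using bounds by (intro tendsto_lowerbound[OF lim]) (auto elim: eventually_mono)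
      then show False using c by simp
    next
      case 2
      have "\<forall>\<^sub>F n in sequentially. \<bar>e n\<bar> < 1"
        using order_tendstoD(2)[OF tendsto_rabs_zero[OF e], of 1] by simp
      with bounds have bound: "\<forall>\<^sub>F n in sequentially. norm (g n) \<le> (\<bar>C\<bar> + 1) * (real n ^ d / real n ^ D)"
        using eventually_gt_at_top[of 0]
      proof eventually_elim
        case (elim n)
        have "\<bar>f v n / real n ^ d\<bar> \<le> \<bar>C\<bar> + 1" using elim(1,2) c by linarith
        then have "\<bar>f v n / real n ^ d\<bar> * (real n ^ d / real n ^ D) \<le> (\<bar>C\<bar> + 1) * (real n ^ d / real n ^ D)"
          by (intro mult_right_mono) auto
        also have "\<bar>f v n / real n ^ d\<bar> * (real n ^ d / real n ^ D) = norm (g n)"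
          using elim(3) by (simp add: g_def abs_divide)
        finally show ?case .
      qed
      have "(\<lambda>n. (\<bar>C\<bar> + 1) * (real n ^ d / real n ^ D)) \<longlonglongrightarrow> (\<bar>C\<bar> + 1) * 0"
        using 2 by (intro tendsto_mult tendsto_const power_quotient_tendsto_0)
      then have "(\<lambda>n. (\<bar>C\<bar> + 1) * (real n ^ d / real n ^ D)) \<longlonglongrightarrow> 0" by (simp only: mult_zero_right)
      with bound have "g \<longlonglongrightarrow> 0" by (rule Lim_null_comparison)
      then have "real_of_rat (lead_coeff (p v)) = 0" using g LIMSEQ_unique by blast
      then have "p v = 0" by simp
      then show False using 2 by (simp add: D_def)
    qed
  qed
qed

text \<open>
  With one more edge the main term gains a factor \<open>n\<close> over the error term. The constant comes from
  \<open>n - 1 \<ge> n / 2\<close>, which costs \<open>2 ^ d\<close>, from the lost factor \<open>v\<close>, and from using up half of the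
  main term to absorb the error.
\<close>

lemma growth_step_lower:
  fixes c v C :: real
  assumes c: "0 < c" and v: "1 \<le> v" and C: "0 \<le> C"
  shows "\<exists>N. \<forall>n\<ge>N. c / (2 * v * 2 ^ d) * real n ^ Suc d * v ^ n
      \<le> real n * (c * real (n - 1) ^ d * v ^ (n - 1)) - C * real n ^ d * v ^ n"
proof -
  define b where "b = c / (2 * v * 2 ^ d)"
  have b: "0 < b" using c v by (simp add: b_def)
  obtain N where N: "real N \<ge> C / b" using real_arch_simple by blast
  have "b * real n ^ Suc d * v ^ n \<le> real n * (c * real (n - 1) ^ d * v ^ (n - 1)) - C * real n ^ d * v ^ n"
    if n: "n \<ge> max 2 N" for n
  proof -
    have "real n / 2 \<le> real (n - 1)" using n by simp
    then have "(real n / 2) ^ d \<le> real (n - 1) ^ d" by (intro power_mono) auto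
    then have "real n * (c * (real n / 2) ^ d * v ^ (n - 1)) \<le> real n * (c * real (n - 1) ^ d * v ^ (n - 1))"
      using c v by (intro mult_left_mono mult_right_mono) auto
    moreover have "real n * (c * (real n / 2) ^ d * v ^ (n - 1)) = 2 * b * real n ^ Suc d * v ^ n"
    proof -
      have "v ^ n = v * v ^ (n - 1)" using n by (simp flip: power_Suc)
      then show ?thesis using v by (simp add: b_def power_divide field_simps)
    qed
    moreover have "C * (real n ^ d * v ^ n) \<le> (b * real n) * (real n ^ d * v ^ n)"
    proof (rule mult_right_mono)
      have "C / b \<le> real n" using N n by simp
      then show "C \<le> b * real n" using b by (simp add: field_simps)
    qed (use v in auto)
    moreover have "(b * real n) * (real n ^ d * v ^ n) = b * real n ^ Suc d * v ^ n"
      "C * (real n ^ d * v ^ n) = C * real n ^ d * v ^ n"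
      "2 * b * real n ^ Suc d * v ^ n = 2 * (b * real n ^ Suc d * v ^ n)" by simp_all
    ultimately show ?thesis by linarith
  qed
  then show ?thesis unfolding b_def by blast
qed

section \<open>Growth of the top homology\<close>

text \<open>
  Induction over the edges of the subgraph. The same statement carries upper and lower bounds, as the
  lower bound for one more edge subtracts the upper bound for the smaller subgraph.
\<close>

lemma sink_conf_homology_growth:
  assumes graph: "CW_graph X V E" and F: "F \<subseteq> E"
  shows "\<exists>C c N. 0 \<le> C \<and> 0 < c \<and> (\<forall>I :: nat set. finite I \<longrightarrow>
     (\<forall>p > int (card F). trivial_group (homology_group p (sink_conf I (subtopology X (V \<union> \<Union>F)) V))) \<and>
     (\<exists>r. int_rank (homology_group (int (card F)) (sink_conf I (subtopology X (V \<union> \<Union>F)) V)) = enat r \<and>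
        real r \<le> C * real (card I) ^ card F * real (card V) ^ card I \<and>
        (N \<le> card I \<longrightarrow> c * real (card I) ^ card F * real (card V) ^ card I \<le> real r)))"
proof -
  have "finite F" using F CW_graph_finite_edges[OF graph] by (rule finite_subset)
  have v: "1 \<le> real (card V)"
    using CW_graph_finite_vertices[OF graph] CW_graph_vertices_nonempty[OF graph]
    by (simp add: Suc_le_eq card_gt_0_iff)
  from \<open>finite F\<close> F show ?thesis
  proof (induction F rule: finite_induct)
    case empty
    have X: "Hausdorff_space X" "V \<subseteq> topspace X"
      using graph by (auto simp: CW_graph_def CW_complex_1_def)
    note base = X(1) CW_graph_finite_vertices[OF graph] X(2)
    show ?case
      using trivial_homology_sink_conf_vertices[OF base] int_rank_homology_sink_conf_vertices[OF base]
      by (intro exI[of _ 1] exI[of _ 1] exI[of _ 0]) auto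
  next
    case (insert e F)
    let ?v = "real (card V)"
    define d where "d = card F"
    have cardF: "card (insert e F) = Suc d" using insert.hyps by (simp add: d_def)
    let ?W = "\<lambda>I. sink_conf I (subtopology X (V \<union> \<Union>F)) V"
    let ?Y = "\<lambda>I. sink_conf I (subtopology X (V \<union> \<Union>(insert e F))) V"
    have "F \<subseteq> E" using insert.prems by simp
    then obtain C c N where C: "0 \<le> C" and c: "0 < c"
      and IH: "\<And>I :: nat set. finite I \<Longrightarrow>
        (\<forall>p > int d. trivial_group (homology_group p (?W I))) \<and>
        (\<exists>r. int_rank (homology_group (int d) (?W I)) = enat r \<and>
          real r \<le> C * real (card I) ^ d * ?v ^ card I \<and>
          (N \<le> card I \<longrightarrow> c * real (card I) ^ d * ?v ^ card I \<le> real r))"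
      using insert.IH unfolding d_def by meson
    have vanish: "trivial_group (homology_group p (?W I))" if "finite I" "p > int d" for I :: "nat set" and p
      using IH[OF that(1)] that(2) by blast
    have rk: "\<exists>r. int_rank (homology_group (int d) (?W I)) = enat r \<and>
          real r \<le> C * real (card I) ^ d * ?v ^ card I \<and>
          (N \<le> card I \<longrightarrow> c * real (card I) ^ d * ?v ^ card I \<le> real r)" if "finite I" for I :: "nat set"
      using IH[OF that] by blast
    obtain r where r: "\<And>I :: nat set. finite I \<Longrightarrow> int_rank (homology_group (int d) (?W I)) = enat (r I)"
      and r_upper: "\<And>I :: nat set. finite I \<Longrightarrow> real (r I) \<le> C * real (card I) ^ d * ?v ^ card I"
      and r_lower: "\<And>I :: nat set. finite I \<Longrightarrow> N \<le> card I \<Longrightarrow> c * real (card I) ^ d * ?v ^ card I \<le> real (r I)"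
      using rk by metis
    define c' where "c' = c / (2 * ?v * 2 ^ d)"
    obtain M where M: "\<And>n. n \<ge> M \<Longrightarrow> c' * real n ^ Suc d * ?v ^ n
        \<le> real n * (c * real (n - 1) ^ d * ?v ^ (n - 1)) - C * real n ^ d * ?v ^ n"
      using growth_step_lower[OF c v C, of d] unfolding c'_def by blast
    obtain \<delta> h \<phi> K where "edge_deformation (subtopology X (V \<union> \<Union>(insert e F))) (V \<union> \<Union>F) V \<delta> h \<phi> K"
      using subgraph_edge_deformation[OF graph _ _ insert.hyps(2)] insert.prems by blast
    then interpret edge_deformation "subtopology X (V \<union> \<Union>(insert e F))" "V \<union> \<Union>F" V \<delta> h \<phi> K .
    have sub: "subtopology (subtopology X (V \<union> \<Union>(insert e F))) (V \<union> \<Union>F) = subtopology X (V \<union> \<Union>F)"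
    proof -
      have "(V \<union> \<Union>(insert e F)) \<inter> (V \<union> \<Union>F) = V \<union> \<Union>F" by blast
      then show ?thesis by (simp only: subtopology_subtopology)
    qed
    have "(\<forall>p > int (Suc d). trivial_group (homology_group p (?Y I))) \<and>
       (\<exists>s. int_rank (homology_group (int (Suc d)) (?Y I)) = enat s \<and>
          real s \<le> 2 * C * real (card I) ^ Suc d * ?v ^ card I \<and>
          (max M (Suc N) \<le> card I \<longrightarrow> c' * real (card I) ^ Suc d * ?v ^ card I \<le> real s))"
      if I: "finite I" for I :: "nat set"
    proof -
      define n where "n = card I"
      have I': "finite (I - {i})" "card (I - {i}) = n - 1" if "i \<in> I" for i
        using I that by (simp_all add: n_def)
      define S where "S = (\<Sum>i\<in>I. r (I - {i}))"
      have S: "(\<Sum>i\<in>I. int_rank (homology_group (int d) (?W (I - {i})))) = enat S"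
      proof -
        have "(\<Sum>i\<in>I. int_rank (homology_group (int d) (?W (I - {i})))) = (\<Sum>i\<in>I. enat (r (I - {i})))"
          using r[OF I'(1)] by (intro sum.cong) auto
        also have "\<dots> = enat S" unfolding S_def by (simp flip: of_nat_eq_enat)
        finally show ?thesis .
      qed
      have van: "trivial_group (homology_group p (?W I))" if "p > int d" for p
        using vanish[OF I that] .
      have van': "trivial_group (homology_group p (?W (I - {i})))" if "p > int d" "i \<in> I" for p i
        using vanish[OF I'(1)[OF that(2)] that(1)] .
      note step = homology_sink_conf_vanish[where d = "int d", OF I, unfolded sub, OF van van']
        int_rank_homology_sink_conf_upper[where d = "int d", OF I, unfolded sub, OF van van']
        int_rank_homology_sink_conf_lower[where d = "int d", OF I, unfolded sub, OF van van']
      have d1: "int d + 1 = int (Suc d)" by simp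
      have S2: "2 * enat S = enat (2 * S)" by (simp add: numeral_eq_enat)
      have le: "int_rank (homology_group (int (Suc d)) (?Y I)) \<le> enat (2 * S)"
        using step(2) unfolding S d1 S2 .
      then obtain s where s: "int_rank (homology_group (int (Suc d)) (?Y I)) = enat s"
        using enat_ile by blast
      have upper: "s \<le> 2 * S" using le s by simp
      have "enat (2 * S) \<le> enat s + enat (r I) + enat S"
        using step(3) unfolding S d1 s r[OF I] S2 .
      then have lower: "S \<le> s + r I" by simp
      have "real S = (\<Sum>i\<in>I. real (r (I - {i})))" by (simp add: S_def)
      also have "\<dots> \<le> (\<Sum>i\<in>I. C * real n ^ d * ?v ^ n)"
      proof (rule sum_mono)
        fix i assume i: "i \<in> I"
        have "real (r (I - {i})) \<le> C * real (n - 1) ^ d * ?v ^ (n - 1)"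
          using r_upper[OF I'(1)[OF i]] I'(2)[OF i] by simp
        also have "\<dots> \<le> C * real n ^ d * ?v ^ n"
          using C v by (intro mult_mono mult_left_mono power_mono power_increasing) auto
        finally show "real (r (I - {i})) \<le> C * real n ^ d * ?v ^ n" .
      qed
      also have "\<dots> = C * real n ^ Suc d * ?v ^ n" by (simp add: n_def)
      finally have "real s \<le> 2 * C * real n ^ Suc d * ?v ^ n" using upper by simp
      moreover have "c' * real n ^ Suc d * ?v ^ n \<le> real s" if n: "max M (Suc N) \<le> n"
      proof -
        have "real n * (c * real (n - 1) ^ d * ?v ^ (n - 1)) = (\<Sum>i\<in>I. c * real (n - 1) ^ d * ?v ^ (n - 1))"
          by (simp add: n_def)
        also have "\<dots> \<le> (\<Sum>i\<in>I. real (r (I - {i})))"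
          using r_lower[OF I'(1)] I'(2) n by (intro sum_mono) auto
        also have "\<dots> = real S" by (simp add: S_def)
        also have "\<dots> \<le> real s + real (r I)" using lower by simp
        also have "\<dots> \<le> real s + C * real n ^ d * ?v ^ n" using r_upper[OF I] by (simp add: n_def)
        finally show ?thesis using M[of n] n by simp
      qed
      moreover have "trivial_group (homology_group p (?Y I))" if "p > int (Suc d)" for p
        using step(1)[of p] that by simp
      ultimately show ?thesis using s unfolding n_def by blast
    qed
    moreover have "0 \<le> 2 * C" "0 < c'" using C c v by (auto simp: c'_def)
    ultimately show ?case unfolding cardF by blast
  qed
qed

theorem theorem4p4:
  fixes X :: "'a topology" and V :: "'a set" and E :: "'a set set"
  assumes "CW_graph X V E"
  shows "(\<forall>p :: nat \<Rightarrow> rat poly.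
            (\<forall>\<^sub>F n in sequentially.
               \<exists>r :: nat. int_rank (homology_group (int (card E)) (conf_sink n X V)) = enat r \<and>
                 (of_nat r :: rat) = (\<Sum>j = 1..card V. poly (p j) (of_nat n) * of_nat j ^ n))
            \<longrightarrow> degree (p (card V)) = card E) \<and>
         (\<forall>\<^sub>F n in sequentially. has_homological_dimension (conf_sink n X V) (card E))"
proof -
  have v: "1 \<le> card V"
    using CW_graph_finite_vertices[OF assms] CW_graph_vertices_nonempty[OF assms]
    by (simp add: Suc_le_eq card_gt_0_iff)
  have conf: "sink_conf {1..n} (subtopology X (V \<union> \<Union>E)) V = conf_sink n X V" for n
  proof -
    have "V \<union> \<Union>E = topspace X" using assms by (auto simp: CW_graph_def CW_complex_1_def)
    then show ?thesis by (simp add: conf_sink_eq_sink_conf)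
  qed
  obtain C c N where c: "0 < c"
    and growth: "\<forall>I :: nat set. finite I \<longrightarrow>
     (\<forall>p > int (card E). trivial_group (homology_group p (sink_conf I (subtopology X (V \<union> \<Union>E)) V))) \<and>
     (\<exists>r. int_rank (homology_group (int (card E)) (sink_conf I (subtopology X (V \<union> \<Union>E)) V)) = enat r \<and>
        real r \<le> C * real (card I) ^ card E * real (card V) ^ card I \<and>
        (N \<le> card I \<longrightarrow> c * real (card I) ^ card E * real (card V) ^ card I \<le> real r))"
    using sink_conf_homology_growth[OF assms order_refl] by auto
  have growth_n: "(\<forall>p > int (card E). trivial_group (homology_group p (conf_sink n X V))) \<and>
     (\<exists>r. int_rank (homology_group (int (card E)) (conf_sink n X V)) = enat r \<and>
        real r \<le> C * real n ^ card E * real (card V) ^ n \<and>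
        (N \<le> n \<longrightarrow> c * real n ^ card E * real (card V) ^ n \<le> real r))" for n
    using growth[THEN spec, of "{1..n}"] unfolding conf by simp
  have vanish: "trivial_group (homology_group p (conf_sink n X V))" if "p > int (card E)" for p n
    using growth_n that by blast
  have rank: "\<exists>r. int_rank (homology_group (int (card E)) (conf_sink n X V)) = enat r \<and>
        real r \<le> C * real n ^ card E * real (card V) ^ n \<and>
        (N \<le> n \<longrightarrow> c * real n ^ card E * real (card V) ^ n \<le> real r)" for n
    using growth_n by blast
  have "degree (p (card V)) = card E"
    if p: "\<forall>\<^sub>F n in sequentially.
               \<exists>r :: nat. int_rank (homology_group (int (card E)) (conf_sink n X V)) = enat r \<and>
                 (of_nat r :: rat) = (\<Sum>j = 1..card V. poly (p j) (of_nat n) * of_nat j ^ n)"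
    for p :: "nat \<Rightarrow> rat poly"
  proof (rule degree_dominant_polynomial[OF v c])
    have eq: "\<forall>\<^sub>F n in sequentially. \<exists>r. int_rank (homology_group (int (card E)) (conf_sink n X V)) = enat r \<and>
        real r = real_of_rat (\<Sum>j = 1..card V. poly (p j) (of_nat n) * of_nat j ^ n)"
      using p by eventually_elim (metis of_rat_of_nat_eq)
    show "\<forall>\<^sub>F n in sequentially. c * real n ^ card E * real (card V) ^ n
        \<le> real_of_rat (\<Sum>j = 1..card V. poly (p j) (of_nat n) * of_nat j ^ n)"
      using eq eventually_ge_at_top[of N]
    proof eventually_elim
      case (elim n)
      then show ?case using rank[of n] by auto
    qed
    show "\<forall>\<^sub>F n in sequentially.
        real_of_rat (\<Sum>j = 1..card V. poly (p j) (of_nat n) * of_nat j ^ n)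
          \<le> C * real n ^ card E * real (card V) ^ n"
      using eq
    proof eventually_elim
      case (elim n)
      then show ?case using rank[of n] by auto
    qed
  qed
  moreover have "\<forall>\<^sub>F n in sequentially. has_homological_dimension (conf_sink n X V) (card E)"
    using eventually_ge_at_top[of "max 1 N"]
  proof eventually_elim
    case (elim n)
    have "\<not> trivial_group (homology_group (int (card E)) (conf_sink n X V))"
    proof
      assume "trivial_group (homology_group (int (card E)) (conf_sink n X V))"
      from int_rank_trivial_group[OF this]
      have "c * real n ^ card E * real (card V) ^ n \<le> 0"
        using rank[of n] elim by (auto simp: zero_enat_def)
      moreover have "0 < c * real n ^ card E * real (card V) ^ n"
        using elim c v by simp
      ultimately show False by simp
    qed
    then show ?case
      unfolding has_homological_dimension_def using vanish by auto
  qed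
  ultimately show ?thesis by blast
qed

end
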